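(* Let $p$ be an odd prime, $l\in\mathbb Z$, $n\ge 0$ an integer, and assume that $r=n/(p-1)$ is a nonnegative integer. Let $M$ be the maximum pole of $B_n^{(l)}(x)$ and $M'$ the maximum pole of $B_n^{(l+1)}(x)$. Let $u$ be the partition with $u_{p-1}=r$ and all other $u_i=0$, and let $\tau_u=\tau_u(l-n-1)=n!\binom{l-n-1}{r}/p^r$. Then: (a) $B_n^{(l-1)}(x)$ is a shifted almost maximum pole case (SAMPC) if and only if $\nu_p\left(\binom{l-n-1}{r}\right)=\sigma_p(n)/(p-1)-M$, which is equivalent to $\nu_p(\tau_u)=-M=\nu_p(B_n^{(l)}(1))$. (b) If $\nu_p(l)\le\nu_p(n)$, then $B_n^{(l)}(x)$ is an almost maximum pole case (AMPC) if and only if $\nu_p(\tau_u)=-M=\nu_p(B_n^{(l)})$, which is equivalent to $\nu_p\left(\binom{l-n-1}{r}\right)=\sigma_p(n)/(p-1)-M$. Hence, under the assumption $\nu_p(l)\le\nu_p(n)$, $B_n^{(l-1)}(x)$ is a SAMPC if and only if $B_n^{(l)}(x)$ is an AMPC, and if $B_n^{(l-1)}(x)$ is a SAMPC or $B_n^{(l)}(x)$ is an AMPC, then $\nu_p(B_n^{(l)})=\nu_p(B_n^{(l)}(1))$. (c) If $\nu_p(l)>\nu_p(n)$, then $\nu_p(l+1)\le\nu_p(n)$, so (b) applies with $l$ replaced by $l+1$ and $M$ replaced by $M'$; that is, $B_n^{(l+1)}(x)$ is an AMPC if and only if $\nu_p(\tau_u(l-n))=-M'=\nu_p(B_n^{(l+1)})$,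 where $\tau_u(l-n)=n!\binom{l-n}{r}/p^r$, which is equivalent to $\nu_p\left(\binom{l-n}{r}\right)=\sigma_p(n)/(p-1)-M'$; $B_n^{(l)}(x)$ is a SAMPC if and only if $B_n^{(l+1)}(x)$ is an AMPC; and if either holds, then $\nu_p(B_n^{(l+1)})=\nu_p(B_n^{(l+1)}(1))$.
   Context: $\sigma_p(m)$ is the sum of the base $p$ digits of $m\ge 0$; $\nu_p$ is the $p$-adic valuation, with $\nu_p(0)=\infty$. For $s\in\mathbb Z$ and $d\ge 0$, $\binom sd=s(s-1)\cdots(s-d+1)/d!$. Higher order Bernoulli polynomials $B_n^{(l)}(x)$ ($n\ge 0$, $l\in\mathbb Z$) are defined by $\left(\frac{t}{e^t-1}\right)^l e^{tx}=\sum_{n\ge 0}B_n^{(l)}(x)\frac{t^n}{n!}$; $B_n^{(l)}(x)$ is monic of degree $n$ with rational coefficients, and $B_n^{(l)}=B_n^{(l)}(0)$. The maximum pole (with respect to $p$) of a nonzero rational polynomial is the integer $M$ such that $-M$ is the minimum of the $p$-adic valuations of its coefficients. $B_n^{(l)}(x)$ is an almost maximum pole case (AMPC) if $\nu_p(B_n^{(l)})=-M$, where $M$ is the maximum pole of $B_n^{(l)}(x)$. $B_n^{(l)}(x)$ is a shifted almost maximum pole case (SAMPC) if $\nu_p(B_n^{(l+1)}(1))=-M'$, where $M'$ is the maximum pole of $B_n^{(l+1)}(x)$ (equivalently of $B_n^{(l+1)}(x+1)$). A partition is a sequence $u=(u_1,u_2,\dots)$ of nonnegative integers, eventually zero, with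 weight $w(u)=\sum iu_i$ and $d(u)=\sum u_i$. In general, with $s=l-n-1$, $t_u(s)=\binom{s}{d}\binom{d}{u_1\,u_2\,\cdots}\big/\prod_i (i+1)^{u_i}$ and $\tau_u(s)=\frac{n!}{(n-w)!}t_u(s)$; for the partition $u$ of the theorem this is the expression given there. *)

theory Defs
  imports
    "HOL-Computational_Algebra.Computational_Algebra"
    "HOL-Library.Extended_Real"
begin

text \<open>The valuation takes values in the extended reals, so that it can be compared with
  \<open>\<sigma>\<^sub>p(n)/(p-1) - M\<close>, which is an integer only because \<open>p-1\<close> divides \<open>n\<close>.\<close>

definition padic_val :: "nat \<Rightarrow> rat \<Rightarrow> ereal" where
  "padic_val p x =
     (if x = 0 then \<infinity>
      else ereal (of_int (int (multiplicity (int p) (fst (quotient_of x)))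
                        - int (multiplicity (int p) (snd (quotient_of x))))))"

text \<open>For \<open>p \<ge> 2\<close> we have \<open>m < p ^ m\<close>, so all nonzero digits of \<open>m\<close> are at positions below \<open>m\<close>.\<close>

definition digit_sum :: "nat \<Rightarrow> nat \<Rightarrow> nat" where
  "digit_sum p m = (\<Sum>i<m. m div p ^ i mod p)"

text \<open>The generating function \<open>(t / (e^t - 1))^l * e^(t*x)\<close>, as a power series in \<open>t\<close> over
  \<open>\<rat>[x]\<close>. The first factor is formed over the field \<open>\<rat>\<close>, where \<open>t / (e^t - 1)\<close> is a unit (its
  constant term is 1), so that integer powers are the genuine ones, and is then embedded
  coefficientwise into \<open>\<rat>[x][[t]]\<close>.\<close>

definition bernoulli_gf :: "int \<Rightarrow> rat poly fps" where
  "bernoulli_gf l =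
     Abs_fps (\<lambda>k. [:fps_nth ((fps_X / (fps_exp 1 - 1)) powi l) k:])
     * Abs_fps (\<lambda>k. monom (1 / fact k) k)"

definition hbernpoly :: "nat \<Rightarrow> int \<Rightarrow> rat poly" where
  "hbernpoly n l = smult (fact n) (fps_nth (bernoulli_gf l) n)"

text \<open>Zero coefficients have valuation \<open>\<infinity>\<close> and do not affect the minimum. The value is meaningful
  only for nonzero polynomials; see \<open>max_pole_eq\<close> below.\<close>

definition max_pole :: "nat \<Rightarrow> rat poly \<Rightarrow> int" where
  "max_pole p f = (THE M. Min (padic_val p ` set (coeffs f)) = ereal (of_int (- M)))"

definition AMPC :: "nat \<Rightarrow> nat \<Rightarrow> int \<Rightarrow> bool" where
  "AMPC p n l \<longleftrightarrow>
     padic_val p (poly (hbernpoly n l) 0) = ereal (of_int (- max_pole p (hbernpoly n l)))"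

definition SAMPC :: "nat \<Rightarrow> nat \<Rightarrow> int \<Rightarrow> bool" where
  "SAMPC p n l \<longleftrightarrow>
     padic_val p (poly (hbernpoly n (l + 1)) 1)
       = ereal (of_int (- max_pole p (hbernpoly n (l + 1))))"

text \<open>A partition \<open>(u\<^sub>1, u\<^sub>2, \<dots>)\<close> is a finitely supported function on the naturals whose value at 0
  is ignored.\<close>

definition part_supp :: "(nat \<Rightarrow> nat) \<Rightarrow> nat set" where
  "part_supp u = {i. 1 \<le> i \<and> u i \<noteq> 0}"

definition part_weight :: "(nat \<Rightarrow> nat) \<Rightarrow> nat" where
  "part_weight u = (\<Sum>i\<in>part_supp u. i * u i)"

definition part_size :: "(nat \<Rightarrow> nat) \<Rightarrow> nat" where
  "part_size u = (\<Sum>i\<in>part_supp u. u i)"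

definition part_t :: "(nat \<Rightarrow> nat) \<Rightarrow> int \<Rightarrow> rat" where
  "part_t u s =
     (of_int s gchoose part_size u)
     * (fact (part_size u) / (\<Prod>i\<in>part_supp u. fact (u i)))
     / (\<Prod>i\<in>part_supp u. of_nat (i + 1) ^ u i)"

text \<open>Only used for \<open>part_weight u \<le> n\<close>, so the natural number subtraction does not truncate.\<close>

definition part_tau :: "nat \<Rightarrow> (nat \<Rightarrow> nat) \<Rightarrow> int \<Rightarrow> rat" where
  "part_tau n u s = fact n / fact (n - part_weight u) * part_t u s"

lemma coeff_hbernpoly:
  "coeff (hbernpoly n l) i =
     (if i \<le> n then fact n / fact i * fps_nth ((fps_X / (fps_exp 1 - 1)) powi l) (n - i) else 0)"
proof -
  let ?F = "(fps_X / (fps_exp 1 - 1)) powi l :: rat fps"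
  have "fps_nth (bernoulli_gf l) n
      = (\<Sum>k=0..n. smult (fps_nth ?F k) (monom (1 / fact (n - k)) (n - k)))"
    by (simp add: bernoulli_gf_def fps_mult_nth)
  also have "coeff \<dots> i = (\<Sum>k=0..n. if k = n - i \<and> i \<le> n then fps_nth ?F k / fact i else 0)"
    by (simp add: coeff_sum, rule sum.cong) auto
  also have "\<dots> = (if i \<le> n then fps_nth ?F (n - i) / fact i else 0)"
    by (cases "i \<le> n") (simp_all add: sum.delta)
  finally show ?thesis
    by (simp add: hbernpoly_def)
qed

lemma max_pole_eq:
  assumes "f \<noteq> 0"
  shows "Min (padic_val p ` set (coeffs f)) = ereal (of_int (- max_pole p f))"
proof -
  let ?m = "Min (padic_val p ` set (coeffs f))"
  have "lead_coeff f \<in> set (coeffs f)"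
    using assms by (metis coeffs_eq_Nil last_coeffs_eq_coeff_degree last_in_set)
  then have mem: "?m \<in> padic_val p ` set (coeffs f)"
    and le: "?m \<le> padic_val p (lead_coeff f)"
    by (auto intro!: Min_in Min_le)
  from le have "?m \<noteq> \<infinity>"
    using assms by (auto simp: padic_val_def)
  with mem obtain x where x: "?m = padic_val p x" "x \<noteq> 0"
    by (auto simp: padic_val_def)
  then obtain k :: int where k: "?m = ereal (of_int k)"
    unfolding padic_val_def by (metis (full_types))
  show ?thesis
    unfolding max_pole_def by (rule theI[of _ "- k"]) (auto simp: k)
qed

end

theory Submission
  imports Defs
begin

text \<open>
  Write \<open>f = log (1 + z) / z\<close> and \<open>s = l - n - 1\<close>. Lagrange inversion along \<open>z = e^t - 1\<close> gives
  \<open>B\<^sub>n\<^sup>(\<^sup>l\<^sup>)(1) = n! [z^n] f^s\<close> and \<open>B\<^sub>n\<^sup>(\<^sup>l\<^sup>)(0) = l (n-1)! [z^n] (f^s z f')\<close>, and it shows that the divided forward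
  differences of \<open>B\<^sub>n\<^sup>(\<^sup>l\<^sup>)(x)\<close> at \<open>1\<close> are \<open>n!/(n-w)! [z^w] f^s\<close>; hence these numbers have valuation at
  least \<open>-M\<close>. Split \<open>f = U + z^(p-1)/p\<close> and expand
  \<open>f^s = (\<Sum>m. binom s m p^(-m) z^(m(p-1)) U^(s-m))\<close>. The coefficients of powers of \<open>U\<close> have such small
  denominators that modulo \<open>p\<close> times the \<open>\<int>\<^sub>(\<^sub>p\<^sub>)\<close>-span of the numbers
  \<open>\<tau>\<^sub>m = n!/(n-m(p-1))! binom s m / p^m\<close> only the term \<open>\<tau>\<^sub>k\<close> survives in the coefficient with
  \<open>w = k (p-1)\<close>. Therefore every \<open>\<tau>\<^sub>m\<close> has valuation at least \<open>-M\<close>, and \<open>B\<^sub>n\<^sup>(\<^sup>l\<^sup>)(1)\<close> is congruent to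
  \<open>\<tau>\<^sub>r\<close> modulo \<open>p^(1-M)\<close>. In the same way \<open>B\<^sub>n\<^sup>(\<^sup>l\<^sup>)(0)\<close> is congruent to \<open>l / (l - r p) \<tau>\<^sub>r\<close>, and
  \<open>l / (l - r p)\<close> is a \<open>p\<close>-adic unit if \<open>\<nu>\<^sub>p(l) \<le> \<nu>\<^sub>p(n)\<close>.
\<close>

section \<open>Integer powers of power series and Lagrange inversion\<close>

text \<open>Reduces an integer power to the substitution of \<open>U - 1\<close> into (1 + z)^s. The
  laws for sums of exponents, derivatives and composition then follow from those of
  \<open>fps_binomial\<close> without splitting on the sign of \<open>s\<close>.\<close>

lemma fps_powi_conv_compose:
  fixes U :: "'a :: field_char_0 fps"
  assumes "U $ 0 = 1"
  shows "U powi s = fps_binomial (of_int s) oo (U - 1)"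
proof -
  have 0: "(U - 1) $ 0 = 0"
    using assms by simp
  have 1: "(1 + fps_X) ^ n oo (U - 1) = U ^ n" for n
    using 0 by (simp add: fps_compose_power [symmetric] fps_compose_add_distrib)
  show ?thesis
  proof (cases "s \<ge> 0")
    case True
    then obtain n where "s = int n"
      using nonneg_int_cases by blast
    then show ?thesis
      by (simp add: fps_binomial_of_nat 1)
  next
    case False
    then obtain n where n: "s = - int n"
      by (metis nonneg_int_cases linear minus_minus neg_0_le_iff_le)
    with False have "n > 0" by simp
    have "fps_binomial (of_int s) oo (U - 1) = inverse (U ^ n)"
      using 0 by (simp add: n fps_binomial_minus_of_nat fps_inverse_compose 1)
    then show ?thesis
      using False by (simp add: n power_int_def fps_inverse_power)
  qed
qed

lemma fps_powi_add:
  fixes U :: "'a :: field_char_0 fps"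
  assumes "U $ 0 = 1"
  shows "U powi (s + t) = U powi s * U powi t"
  using assms by (simp add: fps_powi_conv_compose fps_binomial_add_mult fps_compose_mult_distrib)

lemma fps_powi_nth_0:
  fixes U :: "'a :: field_char_0 fps"
  assumes "U $ 0 = 1"
  shows "(U powi s) $ 0 = 1"
  using assms by (simp add: fps_powi_conv_compose)

lemma fps_powi_minus_mult:
  fixes U :: "'a :: field_char_0 fps"
  assumes "U $ 0 = 1"
  shows "U powi s * U powi (- s) = 1"
  using fps_powi_add[OF assms, of s "- s"] by simp

lemma fps_powi_mult:
  fixes U V :: "'a :: field_char_0 fps"
  assumes "U $ 0 = 1" "V $ 0 = 1"
  shows "(U * V) powi s = U powi s * V powi s"
proof (cases "s \<ge> 0")
  case True
  then show ?thesis
    by (simp add: power_int_def power_mult_distrib)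
next
  case False
  then show ?thesis
    by (simp add: power_int_def fps_inverse_mult power_mult_distrib)
qed

lemma fps_deriv_powi:
  fixes U :: "'a :: field_char_0 fps"
  assumes "U $ 0 = 1"
  shows "fps_deriv (U powi s) = of_int s * U powi (s - 1) * fps_deriv U"
proof -
  have 0: "(U - 1) $ 0 = 0"
    using assms by simp
  have "fps_deriv (fps_binomial (of_int s :: 'a)) = of_int s * fps_binomial (of_int (s - 1))"
    using fps_binomial_add_mult[of "of_int s :: 'a" "-1"]
    by (simp add: fps_binomial_deriv fps_binomial_minus_one fps_divide_unit fps_of_int)
  then show ?thesis
    using assms 0 by (simp add: fps_powi_conv_compose fps_compose_deriv fps_compose_mult_distrib)
qed

lemma fps_powi_compose:
  fixes U E :: "'a :: field_char_0 fps"
  assumes "U $ 0 = 1" "E $ 0 = 0"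
  shows "U powi s oo E = (U oo E) powi s"
  using assms
  by (simp add: fps_powi_conv_compose fps_compose_sub_distrib flip: fps_compose_assoc)

text \<open>Factor U + Y = U (1 + Y/U) and expand the second factor. The sum stops at
  \<open>n\<close> because \<open>Y\<close> has no constant term, so Y^m starts at index m or
  later.\<close>

lemma fps_powi_add_nth:
  fixes U Y Z :: "'a :: field_char_0 fps"
  assumes "U $ 0 = 1" "Y $ 0 = 0"
  shows "((U + Y) powi s * Z) $ n =
    (\<Sum>m\<le>n. (of_int s gchoose m) * (Y ^ m * U powi (s - int m) * Z) $ n)"
proof -
  let ?V = "Y * U powi (-1)"
  have 1: "(1 + ?V) $ 0 = 1" using assms by simp
  have "U + Y = U * (1 + ?V)"
    using fps_powi_minus_mult[OF assms(1), of 1] by (simp add: algebra_simps)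
  then have "(U + Y) powi s * Z = (1 + ?V) powi s * (U powi s * Z)"
    using fps_powi_mult[OF assms(1) 1] by (simp add: mult_ac)
  also have "\<dots> $ n = (\<Sum>i=0..n. (\<Sum>m=0..i. (of_int s gchoose m) * (?V ^ m) $ i) * (U powi s * Z) $ (n - i))"
    unfolding fps_mult_nth[of "(1 + ?V) powi s" "U powi s * Z"]
    by (subst fps_powi_conv_compose[OF 1]) (simp only: fps_compose_nth fps_binomial_nth add_diff_cancel_left')
  also have "\<dots> = (\<Sum>i=0..n. (\<Sum>m=0..n. (of_int s gchoose m) * (?V ^ m) $ i) * (U powi s * Z) $ (n - i))"
  proof (rule sum.cong[OF refl], rule arg_cong2[where f="(*)"])
    fix i assume i: "i \<in> {0..n}"
    show "(\<Sum>m=0..i. (of_int s gchoose m) * (?V ^ m) $ i) = (\<Sum>m=0..n. (of_int s gchoose m) * (?V ^ m) $ i)"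
      using i assms by (intro sum.mono_neutral_left) (auto simp: startsby_zero_power_prefix)
  qed simp
  also have "\<dots> = (\<Sum>m=0..n. (of_int s gchoose m) * (?V ^ m * (U powi s * Z)) $ n)"
    unfolding fps_mult_nth[of "?V ^ m" "U powi s * Z" for m]
    by (simp only: sum_distrib_left sum_distrib_right mult.assoc) (rule sum.swap)
  also have "\<dots> = (\<Sum>m\<le>n. (of_int s gchoose m) * (Y ^ m * U powi (s - int m) * Z) $ n)"
  proof -
    have *: "(U powi (-1)) ^ m * U powi s = U powi (s - int m)" for m
    proof (induction m)
      case (Suc m)
      then show ?case
        using fps_powi_add[OF assms(1), of "-1" "s - int m"]
        by (simp add: mult.assoc algebra_simps)
    qed simp
    have "?V ^ m * (U powi s * Z) = Y ^ m * U powi (s - int m) * Z" for m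
      unfolding *[symmetric] by (simp add: power_mult_distrib mult_ac)
    then show ?thesis
      by (simp only: atMost_atLeast0)
  qed
  finally show ?thesis .
qed

text \<open>Change of variables in a residue: with E = X G, the left side is the residue of H(E)
  E^(-n-1) dE. The induction peels the constant term off \<open>H\<close>; the rest is divisible by
  E after substitution.\<close>

lemma lagrange_inversion_residue:
  fixes G H :: "'a :: field_char_0 fps"
  assumes "G $ 0 = 1"
  shows "((H oo (fps_X * G)) * G powi (- int n - 1) * fps_deriv (fps_X * G)) $ n = H $ n"
proof (induction n arbitrary: H)
  case 0
  show ?case using assms by (simp add: fps_powi_nth_0)
next
  case (Suc n)
  let ?E = "fps_X * G" and ?k = "- int n - 1"
  define H1 where "H1 = fps_shift 1 H"
  have E0: "?E $ 0 = 0" by simp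
  have H: "H = fps_const (H $ 0) + fps_X * H1"
    by (rule fps_ext) (simp add: H1_def)
  have "H oo ?E = fps_const (H $ 0) + ?E * (H1 oo ?E)"
    by (subst H) (simp add: fps_compose_add_distrib fps_compose_mult_distrib[OF E0])
  then have split: "((H oo ?E) * G powi (?k - 1) * fps_deriv ?E) $ Suc n =
     H $ 0 * (G powi (?k - 1) * fps_deriv ?E) $ Suc n
     + (?E * (H1 oo ?E) * G powi (?k - 1) * fps_deriv ?E) $ Suc n"
    by (simp add: algebra_simps del: fps_deriv_mult of_nat_Suc)
  have G: "G * G powi (?k - 1) = G powi ?k"
  proof -
    have "1 + (?k - 1) = ?k" by simp
    then show ?thesis
      using fps_powi_add[OF assms, of 1 "?k - 1"] by (simp only: power_int_1_right)
  qed
  have "?E * (H1 oo ?E) * G powi (?k - 1) * fps_deriv ?E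
      = fps_X * ((H1 oo ?E) * (G * G powi (?k - 1)) * fps_deriv ?E)"
    by (simp only: mult_ac)
  also have "\<dots> $ Suc n = ((H1 oo ?E) * G powi (- int n - 1) * fps_deriv ?E) $ n"
    unfolding G by (simp add: mult.assoc del: fps_deriv_mult)
  finally have 1: "(?E * (H1 oo ?E) * G powi (?k - 1) * fps_deriv ?E) $ Suc n = H $ Suc n"
    using Suc.IH[of H1] by (simp add: H1_def del: fps_deriv_mult)
  \<comment> \<open>The constant term of \<open>H\<close> contributes a multiple of the residue of
    E^(-n-2) E'. It vanishes because E^(-n-2) E' is, up to a constant factor, a derivative; this is
    checked here on coefficients.\<close>
  have "G powi (?k - 1) * fps_deriv ?E = G powi ?k + fps_X * (G powi (?k - 1) * fps_deriv G)"
    unfolding G[symmetric] by (simp add: algebra_simps)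
  moreover have "(of_int ?k :: 'a) * (G powi (?k - 1) * fps_deriv G) $ n = of_nat (Suc n) * (G powi ?k) $ Suc n"
  proof -
    have "of_nat (Suc n) * (G powi ?k) $ Suc n = fps_deriv (G powi ?k) $ n"
      by simp
    also have "\<dots> = of_int ?k * (G powi (?k - 1) * fps_deriv G) $ n"
      unfolding fps_deriv_powi[OF assms] by (simp add: mult.assoc flip: fps_of_int)
    finally show ?thesis by simp
  qed
  then have *: "of_nat (Suc n) * (G powi ?k) $ Suc n = - (of_nat (Suc n) * (G powi (?k - 1) * fps_deriv G) $ n)"
    by (simp add: algebra_simps)
  have "of_nat (Suc n) * ((G powi (?k - 1) * fps_deriv G) $ n + (G powi ?k) $ Suc n) = 0"
    unfolding distrib_left * by (rule add.right_inverse)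
  then have "(G powi (?k - 1) * fps_deriv G) $ n = - ((G powi ?k) $ Suc n)"
    by (simp only: mult_eq_0_iff of_nat_eq_0_iff eq_neg_iff_add_eq_0 nat.distinct simp_thms)
  ultimately have "(G powi (?k - 1) * fps_deriv ?E) $ Suc n = 0"
    by (simp del: fps_deriv_mult)
  with split 1 have "((H oo ?E) * G powi (?k - 1) * fps_deriv ?E) $ Suc n = H $ Suc n"
    by (simp only: mult_zero_right add_0)
  moreover have "?k = - int (Suc n)" by simp
  ultimately show ?case by (simp only:)
qed

section \<open>Valuations and digit sums\<close>

text \<open>\<open>pdiv p e x\<close> expresses \<open>\<nu>\<^sub>p(x) \<ge> e\<close> in a form closed under ring operations.\<close>

definition pdiv :: "nat \<Rightarrow> int \<Rightarrow> rat \<Rightarrow> bool" where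
  "pdiv p e x \<longleftrightarrow> (\<exists>a b. \<not> int p dvd b \<and> x = of_nat p powi e * of_int a / of_int b)"

lemma pdivI: "\<not> int p dvd b \<Longrightarrow> x = of_nat p powi e * of_int a / of_int b \<Longrightarrow> pdiv p e x"
  unfolding pdiv_def by blast

lemma pdiv_mono:
  assumes "pdiv p e x" "e' \<le> e" "p > 0"
  shows "pdiv p e' x"
proof -
  from assms obtain a b where ab: "\<not> int p dvd b" "x = of_nat p powi e * of_int a / of_int b"
    unfolding pdiv_def by blast
  define k where "k = nat (e - e')"
  have "e = e' + int k"
    using assms(2) by (simp add: k_def)
  then have "x = of_nat p powi e' * of_int (int p ^ k * a) / of_int b"
    using ab(2) assms(3) by (simp add: power_int_add)
  with ab(1) show ?thesis by (rule pdivI)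
qed

lemma pdiv_1_0: "pdiv p 0 1" if "prime p"
  by (rule pdivI[of _ 1 _ _ 1]) (use that in \<open>auto simp: prime_nat_iff\<close>)

lemma pdiv_0 [simp]: "pdiv p e 0" if "prime p"
  by (rule pdivI[of _ 1 _ _ 0]) (use that in \<open>auto simp: prime_nat_iff\<close>)

lemma pdiv_of_int:
  assumes "prime p" "int p ^ k dvd a"
  shows "pdiv p (int k) (of_int a)"
proof -
  from assms(2) obtain c where "a = int p ^ k * c" ..
  then show ?thesis
    by (intro pdivI[of _ 1 _ _ c]) (use assms(1) in \<open>auto simp: prime_nat_iff\<close>)
qed

lemma pdiv_of_int_0: "prime p \<Longrightarrow> pdiv p 0 (of_int a)"
  using pdiv_of_int[of p 0 a] by simp

lemma pdiv_of_int_1: "prime p \<Longrightarrow> int p dvd a \<Longrightarrow> pdiv p 1 (of_int a)"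
  using pdiv_of_int[of p 1 a] by simp

lemma pdiv_inverse_of_int: "\<not> int p dvd b \<Longrightarrow> pdiv p 0 (inverse (of_int b))"
  by (rule pdivI[of _ b _ _ 1]) (auto simp: field_simps)

lemma pdiv_mult:
  assumes "prime p" "pdiv p d x" "pdiv p e y"
  shows "pdiv p (d + e) (x * y)"
proof -
  from assms obtain a b where ab: "\<not> int p dvd b" "x = of_nat p powi d * of_int a / of_int b"
    unfolding pdiv_def by blast
  from assms obtain a' b' where ab': "\<not> int p dvd b'" "y = of_nat p powi e * of_int a' / of_int b'"
    unfolding pdiv_def by blast
  have "\<not> int p dvd b * b'"
    using assms(1) ab(1) ab'(1) by (simp add: prime_dvd_mult_iff)
  moreover have "x * y = of_nat p powi (d + e) * of_int (a * a') / of_int (b * b')"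
    using ab ab' prime_gt_0_nat[OF assms(1)] by (simp add: power_int_add)
  ultimately show ?thesis by (rule pdivI)
qed

lemma pdiv_add:
  assumes "prime p" "pdiv p e x" "pdiv p e y"
  shows "pdiv p e (x + y)"
proof -
  from assms obtain a b where ab: "\<not> int p dvd b" "x = of_nat p powi e * of_int a / of_int b"
    unfolding pdiv_def by blast
  from assms obtain a' b' where ab': "\<not> int p dvd b'" "y = of_nat p powi e * of_int a' / of_int b'"
    unfolding pdiv_def by blast
  have "\<not> int p dvd b * b'"
    using assms(1) ab(1) ab'(1) by (simp add: prime_dvd_mult_iff)
  moreover have "b \<noteq> 0" "b' \<noteq> 0"
    using ab ab' by auto
  then have "x + y = of_nat p powi e * of_int (a * b' + a' * b) / of_int (b * b')"
    using ab ab' by (simp add: field_simps)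
  ultimately show ?thesis by (rule pdivI)
qed

lemma pdiv_mult_left_int: "prime p \<Longrightarrow> pdiv p e x \<Longrightarrow> pdiv p e (of_int a * x)"
  using pdiv_mult[of p 0 "of_int a" e x] pdiv_of_int_0[of p a] by simp

lemma pdiv_uminus: "prime p \<Longrightarrow> pdiv p e x \<Longrightarrow> pdiv p e (- x)"
  using pdiv_mult_left_int[of p e x "- 1"] by simp

lemma pdiv_diff: "prime p \<Longrightarrow> pdiv p e x \<Longrightarrow> pdiv p e y \<Longrightarrow> pdiv p e (x - y)"
  using pdiv_add[of p e x "- y"] pdiv_uminus[of p e y] by simp

lemma pdiv_sum:
  assumes "prime p" "\<And>i. i \<in> S \<Longrightarrow> pdiv p e (f i)"
  shows "pdiv p e (sum f S)"
  using assms(2) by (induction S rule: infinite_finite_induct) (auto intro: pdiv_add assms(1) pdiv_0[OF assms(1)])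

lemma pdiv_of_int_dvd:
  assumes "prime p" "\<not> int p dvd a" "pdiv p e (of_int a * x)"
  shows "pdiv p e x"
proof -
  have "pdiv p (0 + e) (inverse (of_int a) * (of_int a * x))"
    by (intro pdiv_mult pdiv_inverse_of_int assms)
  moreover have "a \<noteq> 0" using assms(2) by auto
  ultimately show ?thesis by (simp flip: mult.assoc)
qed

section \<open>Comparison of \<open>padic_val\<close> with \<open>pdiv\<close>, and
  multiplicativity\<close>

lemma padic_val_normal_form:
  assumes "prime p" "x \<noteq> 0"
  obtains a b v where "\<not> int p dvd a" "\<not> int p dvd b"
    "x = of_nat p powi v * of_int a / of_int b" "padic_val p x = ereal (of_int v)"
proof -
  let ?p = "int p"
  obtain c d where cd: "quotient_of x = (c, d)" by force
  then have x: "x = of_int c / of_int d" and d: "d > 0"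
    by (auto simp: quotient_of_div quotient_of_denom_pos)
  have c: "c \<noteq> 0" using x assms by auto
  have nu: "\<not> is_unit ?p"
    using assms(1) by (auto simp: prime_nat_iff)
  obtain a where a: "c = ?p ^ multiplicity ?p c * a" "\<not> ?p dvd a"
    using multiplicity_decompose'[OF c nu] by metis
  obtain b where b: "d = ?p ^ multiplicity ?p d * b" "\<not> ?p dvd b"
    using multiplicity_decompose'[OF _ nu, of d] d by auto
  let ?v = "int (multiplicity ?p c) - int (multiplicity ?p d)"
  have p: "p > 0" using assms(1) prime_gt_0_nat by blast
  have "x = of_int (?p ^ multiplicity ?p c * a) / of_int (?p ^ multiplicity ?p d * b)"
    using x a(1) b(1) by simp
  also have "\<dots> = of_nat p powi ?v * of_int a / of_int b"
    using p by (simp add: power_int_diff)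
  finally show ?thesis
    by (intro that[OF a(2) b(2)]) (use assms cd in \<open>auto simp: padic_val_def\<close>)
qed

lemma padic_val_ge_iff:
  assumes "prime p"
  shows "ereal (of_int e) \<le> padic_val p x \<longleftrightarrow> pdiv p e x"
proof (cases "x = 0")
  case True
  then show ?thesis using assms by (simp add: padic_val_def)
next
  case False
  have p: "p > 0" using assms(1) prime_gt_0_nat by blast
  obtain a b v where *: "\<not> int p dvd a" "\<not> int p dvd b"
    "x = of_nat p powi v * of_int a / of_int b" "padic_val p x = ereal (of_int v)"
    using padic_val_normal_form[OF assms False] .
  have "pdiv p v x"
    using *(2,3) by (rule pdivI)
  moreover have "e \<le> v" if "pdiv p e x"
  proof (rule ccontr)
    assume "\<not> e \<le> v"
    then have "v + 1 \<le> e" by simp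
    with that have "pdiv p (v + 1) x"
      using p by (rule pdiv_mono)
    then obtain c d where cd: "\<not> int p dvd d" "x = of_nat p powi (v + 1) * of_int c / of_int d"
      unfolding pdiv_def by blast
    have "b \<noteq> 0" "d \<noteq> 0" using * cd by auto
    then have "(of_int (a * d) :: rat) = of_int (int p * c * b)"
      using *(3) cd(2) p by (simp add: power_int_add field_simps)
    then have "a * d = int p * c * b"
      by (simp only: of_int_eq_iff)
    then have "int p dvd a * d" by simp
    then show False
      using assms *(1) cd(1) by (simp add: prime_dvd_mult_iff)
  qed
  ultimately show ?thesis
    using *(4) pdiv_mono[of p v x e] p by auto
qed

lemma padic_val_eq_iff:
  assumes "prime p"
  shows "padic_val p x = ereal (of_int e) \<longleftrightarrow> pdiv p e x \<and> \<not> pdiv p (e + 1) x"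
proof (cases "x = 0")
  case True
  then show ?thesis using assms by (simp add: padic_val_def)
next
  case False
  then obtain v :: int where "padic_val p x = ereal (of_int v)"
    by (rule padic_val_normal_form[OF assms])
  then show ?thesis
    unfolding padic_val_ge_iff[OF assms, symmetric] by auto
qed

lemma padic_val_unit:
  assumes "prime p" "\<not> int p dvd a" "\<not> int p dvd b"
  shows "padic_val p (of_nat p powi v * of_int a / of_int b) = ereal (of_int v)"
proof -
  let ?x = "of_nat p powi v * of_int a / of_int b :: rat"
  have p: "p > 0" using assms(1) prime_gt_0_nat by blast
  have "pdiv p v ?x"
    using assms(3) by (rule pdivI) (rule refl)
  moreover have "\<not> pdiv p (v + 1) ?x"
  proof
    assume "pdiv p (v + 1) ?x"
    then obtain c d where cd: "\<not> int p dvd d" "?x = of_nat p powi (v + 1) * of_int c / of_int d"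
      unfolding pdiv_def by blast
    have "b \<noteq> 0" "d \<noteq> 0" using assms cd by auto
    then have "(of_int (a * d) :: rat) = of_int (int p * c * b)"
      using cd(2) p by (simp add: power_int_add field_simps)
    then have "a * d = int p * c * b"
      by (simp only: of_int_eq_iff)
    then have "int p dvd a * d" by simp
    then show False
      using assms cd(1) by (simp add: prime_dvd_mult_iff)
  qed
  ultimately show ?thesis
    using padic_val_eq_iff[OF assms(1)] by blast
qed

lemma padic_val_mult:
  assumes "prime p"
  shows "padic_val p (x * y) = padic_val p x + padic_val p y"
proof (cases "x = 0 \<or> y = 0")
  case True
  have "padic_val p z \<noteq> - \<infinity>" for z
    by (auto simp: padic_val_def)
  with True show ?thesis
    by (auto simp: padic_val_def)
next
  case False
  have p: "p > 0" using assms(1) prime_gt_0_nat by blast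
  from False have "x \<noteq> 0" "y \<noteq> 0" by auto
  from \<open>x \<noteq> 0\<close> obtain a b v where x: "\<not> int p dvd a" "\<not> int p dvd b"
    "x = of_nat p powi v * of_int a / of_int b" "padic_val p x = ereal (of_int v)"
    by (rule padic_val_normal_form[OF assms])
  from \<open>y \<noteq> 0\<close> obtain c d w where y: "\<not> int p dvd c" "\<not> int p dvd d"
    "y = of_nat p powi w * of_int c / of_int d" "padic_val p y = ereal (of_int w)"
    by (rule padic_val_normal_form[OF assms])
  have "x * y = of_nat p powi (v + w) * of_int (a * c) / of_int (b * d)"
    using x(3) y(3) p by (simp add: power_int_add)
  then have "padic_val p (x * y) = ereal (of_int (v + w))"
    using padic_val_unit[OF assms, of "a * c" "b * d" "v + w"] x(1,2) y(1,2) assms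
    by (simp add: prime_dvd_mult_iff)
  then show ?thesis
    using x(4) y(4) by simp
qed

lemma padic_val_power_self: "prime p \<Longrightarrow> padic_val p (of_nat p ^ k) = ereal (real k)"
  using padic_val_unit[of p 1 1 "int k"] by (auto simp: prime_nat_iff)

lemma padic_val_of_int_unit: "prime p \<Longrightarrow> \<not> int p dvd a \<Longrightarrow> padic_val p (of_int a) = 0"
  using padic_val_unit[of p a 1 0] by (auto simp: prime_nat_iff zero_ereal_def)

section \<open>Digit sums and Legendre's formula\<close>

text \<open>The summation range in \<open>digit_sum\<close> depends on the argument; a free upper
  bound makes the sums for \<open>m\<close> and \<open>m div p\<close> comparable.\<close>

lemma digit_sum_eq:
  assumes "p \<ge> 2" "N \<ge> m"
  shows "digit_sum p m = (\<Sum>i<N. m div p ^ i mod p)"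
  unfolding digit_sum_def
proof (rule sum.mono_neutral_left)
  show "\<forall>i\<in>{..<N} - {..<m}. m div p ^ i mod p = 0"
  proof
    fix i assume "i \<in> {..<N} - {..<m}"
    then have "p ^ m \<le> p ^ i"
      using assms by (intro power_increasing) auto
    moreover have "m < p ^ m"
      using assms(1) by (intro power_gt_expt) auto
    ultimately show "m div p ^ i mod p = 0" by simp
  qed
qed (use assms in auto)

lemma digit_sum_rec:
  assumes "p \<ge> 2"
  shows "digit_sum p m = m mod p + digit_sum p (m div p)"
proof -
  have "digit_sum p m = (\<Sum>i<Suc m. m div p ^ i mod p)"
    using assms by (intro digit_sum_eq) auto
  also have "\<dots> = m mod p + (\<Sum>i<m. m div p div p ^ i mod p)"
    unfolding sum.lessThan_Suc_shift by (simp add: div_mult2_eq)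
  also have "(\<Sum>i<m. m div p div p ^ i mod p) = digit_sum p (m div p)"
    using assms by (intro digit_sum_eq[symmetric]) auto
  finally show ?thesis .
qed

text \<open>Adding 1 to \<open>n\<close> turns the trailing digits p - 1 into 0, one for each factor
  p of n + 1, and raises the next digit by 1. The induction removes one trailing digit at a
  time.\<close>

lemma padic_val_Suc:
  assumes "prime p"
  shows "padic_val p (of_nat (Suc n)) =
           ereal ((1 + real (digit_sum p n) - real (digit_sum p (Suc n))) / real (p - 1))"
proof (induction n rule: less_induct)
  case (less n)
  have p: "p \<ge> 2" using assms prime_ge_2_nat by blast
  show ?case
  proof (cases "p dvd Suc n")
    case False
    then have "Suc n div p = n div p" "Suc n mod p = Suc (n mod p)"
      by (auto simp: div_Suc mod_Suc dvd_eq_mod_eq_0 split: if_splits)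
    then have "digit_sum p (Suc n) = Suc (digit_sum p n)"
      using digit_sum_rec[OF p, of n] digit_sum_rec[OF p, of "Suc n"] by simp
    moreover have "padic_val p (of_nat (Suc n)) = 0"
      using padic_val_of_int_unit[OF assms, of "int (Suc n)"] False
      by (simp del: of_nat_Suc)
    ultimately show ?thesis by (simp add: zero_ereal_def del: of_nat_Suc)
  next
    case True
    then obtain j where j: "Suc n = p * j" by auto
    then obtain k where k: "j = Suc k" by (cases j) auto
    have n: "n = (p - 1) + p * k" using j k p by (simp add: algebra_simps)
    have "digit_sum p n = (p - 1) + digit_sum p k"
    proof -
      have "n mod p = p - 1" "n div p = k"
        using p by (simp_all only: n mod_mult_self2 div_mult_self2) simp_all
      then show ?thesis
        using digit_sum_rec[OF p, of n] by simp
    qed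
    moreover have "digit_sum p (Suc n) = digit_sum p (Suc k)"
      using digit_sum_rec[OF p, of "Suc n"] p by (simp add: j k)
    moreover have "k < n"
      using n p by (cases "k = 0") (auto intro: less_le_trans[of k "p * k"])
    then have "padic_val p (of_nat (Suc k)) =
           ereal ((1 + real (digit_sum p k) - real (digit_sum p (Suc k))) / real (p - 1))"
      by (rule less.IH)
    moreover have "padic_val p (of_nat (Suc n)) = 1 + padic_val p (of_nat (Suc k))"
    proof -
      have "padic_val p (of_nat p) = 1"
        using padic_val_power_self[OF assms, of 1] by (simp add: one_ereal_def)
      then show ?thesis
        by (simp only: j k of_nat_mult padic_val_mult[OF assms])
    qed
    ultimately show ?thesis
      using p by (simp add: one_ereal_def field_simps of_nat_diff)
  qed
qed

text \<open>Legendre's formula, by telescoping \<open>padic_val_Suc\<close>.\<close>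

lemma padic_val_fact:
  assumes "prime p"
  shows "padic_val p (fact n) = ereal ((real n - real (digit_sum p n)) / real (p - 1))"
proof (induction n)
  case 0
  show ?case
    using padic_val_of_int_unit[OF assms, of 1] assms
    by (auto simp: digit_sum_def zero_ereal_def prime_nat_iff)
next
  case (Suc n)
  have "padic_val p (fact (Suc n)) = padic_val p (of_nat (Suc n)) + padic_val p (fact n)"
    by (simp add: padic_val_mult[OF assms] del: of_nat_Suc)
  then show ?case
    unfolding padic_val_Suc[OF assms] Suc by (simp add: add_divide_distrib diff_divide_distrib)
qed

section \<open>Higher order Bernoulli polynomials\<close>

abbreviation bern_series :: "rat fps" where
  "bern_series \<equiv> fps_X / (fps_exp 1 - 1)"

section \<open>The substitution z = e^t - 1\<close>

text \<open>This is log (1 + z) / z, written f below.\<close>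

definition log_series :: "rat fps" where
  "log_series = Abs_fps (\<lambda>k. (- 1) ^ k / of_nat (k + 1))"

lemma log_series_nth_0 [simp]: "log_series $ 0 = 1"
  by (simp add: log_series_def)

lemma fps_X_times_log_series: "fps_X * log_series = fps_ln 1"
  by (rule fps_ext) (auto simp: log_series_def fps_ln_nth of_nat_diff)

text \<open>Numerator and denominator of \<open>bern_series\<close> both have zero constant term;
  cancelling the common factor t leaves the inverse of the unit G = (e^t - 1) / t.\<close>

lemma bern_series_obtain:
  obtains G where "fps_exp 1 - 1 = fps_X * G" "G $ 0 = 1" "G * bern_series = 1"
    "bern_series = inverse G"
proof -
  let ?G = "fps_shift 1 (fps_exp (1 :: rat) - 1)"
  have 1: "fps_exp 1 - 1 = fps_X * ?G"
    by (rule fps_ext) auto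
  have 2: "?G $ 0 = 1" by simp
  then have "?G \<noteq> 0" by (metis fps_zero_nth zero_neq_one)
  then have "bern_series = 1 / ?G"
    by (subst 1) (metis fps_X_neq_zero mult.right_neutral nonzero_mult_divide_mult_cancel_left div_mult_mult1)
  then have 3: "bern_series = inverse ?G"
    using 2 by (simp add: fps_divide_unit)
  then have "?G * bern_series = 1"
    using 2 by (metis inverse_mult_eq_1' zero_neq_one)
  with 1 2 3 show ?thesis by (intro that)
qed

lemma bern_series_nth_0 [simp]: "bern_series $ 0 = 1"
  using bern_series_obtain by (metis fps_inverse_nth_0 inverse_1)

text \<open>z f = log (1 + z) is the compositional inverse of e^t - 1, so substitution turns it into
  t.\<close>

lemma log_series_compose: "log_series oo (fps_exp 1 - 1) = bern_series"
proof -
  obtain G where G: "fps_exp 1 - 1 = fps_X * G" "G $ 0 = 1" "G * bern_series = 1"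
    using bern_series_obtain .
  let ?E = "fps_exp (1 :: rat) - 1"
  have E0: "?E $ 0 = 0" by simp
  have "?E * (log_series oo ?E) = (fps_X * log_series) oo ?E"
    using E0 by (simp add: fps_compose_mult_distrib)
  also have "\<dots> = fps_inv ?E oo ?E"
    by (simp add: fps_X_times_log_series fps_ln_fps_exp_inv)
  also have "\<dots> = fps_X"
    by (rule fps_inv) auto
  finally have "fps_X * (G * (log_series oo ?E)) = fps_X * 1"
    unfolding G(1) by (simp add: mult.assoc)
  then have *: "G * (log_series oo ?E) = 1"
    by (rule mult_left_cancel[OF fps_X_neq_zero, THEN iffD1])
  have "log_series oo ?E = (G * bern_series) * (log_series oo ?E)"
    by (simp only: G(3) mult_1_left)
  also have "\<dots> = bern_series * (G * (log_series oo ?E))"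
    by (simp only: mult_ac)
  finally show ?thesis
    by (simp only: * mult_1_right)
qed

lemma lagrange_bern_series:
  "((H oo (fps_exp 1 - 1)) * bern_series powi (int n + 1) * fps_exp 1) $ n = H $ n"
proof -
  obtain G where G: "fps_exp 1 - 1 = fps_X * G" "G $ 0 = 1" "bern_series = inverse G"
    using bern_series_obtain .
  have "G powi (- int n - 1) = inverse G ^ Suc n"
    by (simp add: power_int_def nat_add_distrib)
  also have "\<dots> = bern_series powi (int n + 1)"
    using power_int_of_nat[of bern_series "Suc n"] by (simp add: G(3) add.commute)
  finally have *: "G powi (- int n - 1) = bern_series powi (int n + 1)" .
  have "fps_deriv (fps_X * G) = fps_exp 1"
    by (simp flip: G(1))
  with lagrange_inversion_residue[OF G(2), of H n] show ?thesis
    unfolding * G(1)[symmetric] by simp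
qed

text \<open>Substitution turns f^(l-n-1) into the same power of \<open>bern_series\<close>, and the
  n + 1 further factors in Lagrange inversion raise the exponent to exactly
  \<open>l\<close>.\<close>

lemma bern_series_powi_exp_nth:
  "(bern_series powi l * fps_exp 1) $ n = (log_series powi (l - int n - 1)) $ n"
proof -
  have "(log_series powi (l - int n - 1) oo (fps_exp 1 - 1)) * bern_series powi (int n + 1)
      = bern_series powi l"
    by (simp add: fps_powi_compose log_series_compose flip: fps_powi_add)
  then show ?thesis
    using lagrange_bern_series[of "log_series powi (l - int n - 1)" n] by simp
qed

text \<open>Each factor e^t - 1 cancels one factor \<open>bern_series\<close> and leaves t, so
  \<open>l\<close> and \<open>n\<close> both drop by \<open>k\<close> while l - n - 1 is
  unchanged.\<close>

lemma bern_series_powi_exp_power_nth: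
  assumes "k \<le> n"
  shows "(bern_series powi l * (fps_exp 1 * (fps_exp 1 - 1) ^ k)) $ n =
           (log_series powi (l - int n - 1)) $ (n - k)"
proof -
  obtain G where G: "fps_exp 1 - 1 = fps_X * G" "G $ 0 = 1" "G * bern_series = 1"
    using bern_series_obtain .
  have "bern_series powi l = bern_series ^ k * bern_series powi (l - int k)"
    using fps_powi_add[OF bern_series_nth_0, of "int k" "l - int k"] by simp
  then have eq: "bern_series powi l * (fps_exp 1 * (fps_exp 1 - 1) ^ k) =
      fps_X ^ k * ((G * bern_series) ^ k * (bern_series powi (l - int k) * fps_exp 1))"
    unfolding G(1) by (simp add: power_mult_distrib mult_ac)
  then show ?thesis
    using bern_series_powi_exp_nth[of "l - int k" "n - k"] assms
    unfolding eq G(3) by (simp add: fps_X_power_mult_nth of_nat_diff)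
qed

text \<open>The factor n comes from the operator t d/dt. By the chain rule the derivative of
  \<open>bern_series\<close> is f'(e^t - 1) e^t, so Lagrange inversion applies with H = f^(l-n-1) z
  f'.\<close>

lemma bern_series_powi_nth:
  "of_nat n * (bern_series powi l) $ n =
     of_int l * (log_series powi (l - int n - 1) * (fps_X * fps_deriv log_series)) $ n"
proof -
  obtain G where G: "fps_exp 1 - 1 = fps_X * G" "G $ 0 = 1" "G * bern_series = 1"
    using bern_series_obtain .
  let ?E = "fps_exp (1 :: rat) - 1" and ?P = bern_series and ?s = "l - int n - 1"
  have E0: "?E $ 0 = 0" by simp
  have d: "(fps_deriv log_series oo ?E) * fps_exp 1 = fps_deriv ?P"
    using fps_compose_deriv[OF E0, of log_series] by (simp add: log_series_compose)
  have "((log_series powi ?s * (fps_X * fps_deriv log_series)) oo ?E) * ?P powi (int n + 1) * fps_exp 1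
      = ?P powi ?s * ?P powi (int n + 1) * (?E * ((fps_deriv log_series oo ?E) * fps_exp 1))"
    using E0 by (simp add: fps_compose_mult_distrib fps_powi_compose log_series_compose mult_ac)
  also have "\<dots> = ?P powi l * (?E * fps_deriv ?P)"
    unfolding d by (simp flip: fps_powi_add)
  also have "?P powi l = ?P * ?P powi (l - 1)"
    using fps_powi_add[OF bern_series_nth_0, of 1 "l - 1"] by simp
  also have "?P * ?P powi (l - 1) * (?E * fps_deriv ?P) =
      fps_X * ((G * ?P) * (?P powi (l - 1) * fps_deriv ?P))"
    unfolding G(1) by (simp only: mult_ac)
  finally have "(log_series powi ?s * (fps_X * fps_deriv log_series)) $ n =
      (fps_X * (?P powi (l - 1) * fps_deriv ?P)) $ n"
    using lagrange_bern_series[of "log_series powi ?s * (fps_X * fps_deriv log_series)" n]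
    by (simp only: G(3) mult_1_left)
  then have "of_int l * (log_series powi ?s * (fps_X * fps_deriv log_series)) $ n =
      (fps_X * fps_deriv (?P powi l)) $ n"
    by (cases n) (simp_all add: fps_deriv_powi mult.assoc flip: fps_of_int)
  then show ?thesis by (cases n) simp_all
qed

section \<open>Values at 0 and 1 and divided differences\<close>

lemma poly_hbernpoly_0: "poly (hbernpoly n l) 0 = fact n * (bern_series powi l) $ n"
  by (simp add: poly_0_coeff_0 coeff_hbernpoly)

lemma poly_hbernpoly_1: "poly (hbernpoly n l) 1 = fact n * (log_series powi (l - int n - 1)) $ n"
proof -
  have "degree (hbernpoly n l) \<le> n"
    by (rule degree_le) (simp add: coeff_hbernpoly)
  then have "poly (hbernpoly n l) 1 = (\<Sum>i\<le>n. coeff (hbernpoly n l) i)"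
    by (simp add: poly_altdef) (rule sum.mono_neutral_left, auto simp: coeff_eq_0)
  also have "\<dots> = fact n * (fps_exp 1 * bern_series powi l) $ n"
    by (simp add: coeff_hbernpoly fps_mult_nth sum_distrib_left atMost_atLeast0)
  finally show ?thesis
    unfolding bern_series_powi_exp_nth[symmetric] by (simp only: mult.commute)
qed

text \<open>Multiplying exponential generating functions convolves their coefficients with binomial
  coefficients, which preserves integrality.\<close>

lemma Ints_fact_fps_mult_nth:
  fixes f g :: "rat fps"
  assumes "\<And>i. fact i * f $ i \<in> \<int>" "\<And>i. fact i * g $ i \<in> \<int>"
  shows "fact n * (f * g) $ n \<in> \<int>"
proof -
  have "fact n * (f * g) $ n =
      (\<Sum>i=0..n. of_nat (n choose i) * (fact i * f $ i) * (fact (n - i) * g $ (n - i)))"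
    unfolding fps_mult_nth sum_distrib_left
    by (rule sum.cong) (auto simp: binomial_fact field_simps)
  also have "\<dots> \<in> \<int>"
    by (intro Ints_sum Ints_mult assms) simp
  finally show ?thesis .
qed

text \<open>These series generate the Stirling numbers of the second kind. The derivative of the
  series for k + 1 is e^t times the series for k, which drives the induction.\<close>

lemma Ints_fact_stirling_series_nth:
  "fact i * (fps_const (1 / fact k) * (fps_exp 1 - 1) ^ k) $ i \<in> (\<int> :: rat set)"
proof (induction k arbitrary: i)
  case 0
  show ?case by (cases i) auto
next
  case (Suc k)
  define T :: "nat \<Rightarrow> rat fps" where "T k = fps_const (1 / fact k) * (fps_exp 1 - 1) ^ k" for k
  have IH: "fact i * T k $ i \<in> \<int>" for i
    using Suc.IH by (simp only: T_def)
  have "fact i * T (Suc k) $ i \<in> \<int>"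
  proof (cases i)
    case (Suc j)
    have "fps_deriv (T (Suc k)) = fps_const (1 / fact (Suc k) * of_nat (Suc k)) * (fps_exp 1 - 1) ^ k * fps_exp 1"
      unfolding T_def
      by (simp add: fps_deriv_power mult_ac del: fact_Suc of_nat_Suc power_Suc flip: fps_of_nat)
    also have "1 / fact (Suc k) * of_nat (Suc k) = (1 / fact k :: rat)"
      by simp
    finally have D: "fps_deriv (T (Suc k)) = T k * fps_exp 1"
      by (simp only: T_def)
    have "fact i * T (Suc k) $ i = fact j * (fps_deriv (T (Suc k)) $ j)"
      unfolding fps_deriv_nth Suc fact_Suc by (simp only: Suc_eq_plus1 mult_ac)
    also have "\<dots> \<in> \<int>"
      unfolding D by (intro Ints_fact_fps_mult_nth IH) simp
    finally show ?thesis .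
  qed (simp add: T_def)
  then show ?case by (simp add: T_def)
qed

text \<open>The left side is the divided forward difference of order n - w at 1, since differencing
  e^(xt) in x multiplies it by e^t - 1. The witness for \<open>S i\<close> is this divided
  difference of x^i.\<close>

lemma log_series_powi_nth_conv_hbernpoly:
  assumes "w \<le> n"
  obtains S where "\<forall>i. S i \<in> \<int>"
    "fact n / fact (n - w) * (log_series powi (l - int n - 1)) $ w = (\<Sum>i\<le>n. coeff (hbernpoly n l) i * S i)"
proof -
  define k where "k = n - w"
  define T where "T = fps_const (1 / fact k) * (fps_exp 1 - 1) ^ k * (fps_exp 1 :: rat fps)"
  have k: "k \<le> n" "n - k = w" using assms by (auto simp: k_def)
  have "fact n / fact k * (log_series powi (l - int n - 1)) $ w =
      fact n * (fps_const (1 / fact k) * (bern_series powi l * (fps_exp 1 * (fps_exp 1 - 1) ^ k))) $ n"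
    using bern_series_powi_exp_power_nth[OF k(1), of l] by (simp add: k(2))
  also have "fps_const (1 / fact k) * (bern_series powi l * (fps_exp 1 * (fps_exp 1 - 1) ^ k)) =
      T * bern_series powi l"
    by (simp add: T_def mult_ac)
  also have "fact n * \<dots> $ n = (\<Sum>i\<le>n. coeff (hbernpoly n l) i * (fact i * T $ i))"
    by (simp add: fps_mult_nth sum_distrib_left coeff_hbernpoly atMost_atLeast0 mult_ac)
  finally show ?thesis
    using that[of "\<lambda>i. fact i * T $ i"] Ints_fact_fps_mult_nth[OF Ints_fact_stirling_series_nth[of _ k], of "fps_exp 1"]
    by (simp add: T_def k_def)
qed

lemma pdiv_coeff_hbernpoly:
  assumes "prime p"
  shows "pdiv p (- max_pole p (hbernpoly n l)) (coeff (hbernpoly n l) i)"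
proof (cases "coeff (hbernpoly n l) i = 0")
  case False
  then have ne: "hbernpoly n l \<noteq> 0" by auto
  then have "coeff (hbernpoly n l) i \<in> set (coeffs (hbernpoly n l))"
    using False by (metis coeff_in_coeffs le_degree)
  then have "Min (padic_val p ` set (coeffs (hbernpoly n l))) \<le> padic_val p (coeff (hbernpoly n l) i)"
    by simp
  then show ?thesis
    unfolding max_pole_eq[OF ne] padic_val_ge_iff[OF assms] .
qed (simp add: assms)

lemma pdiv_log_series_powi_nth:
  assumes "prime p" "w \<le> n"
  shows "pdiv p (- max_pole p (hbernpoly n l)) (fact n / fact (n - w) * (log_series powi (l - int n - 1)) $ w)"
proof -
  obtain S where S: "\<forall>i. S i \<in> \<int>"
    "fact n / fact (n - w) * (log_series powi (l - int n - 1)) $ w = (\<Sum>i\<le>n. coeff (hbernpoly n l) i * S i)"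
    by (rule log_series_powi_nth_conv_hbernpoly[OF assms(2), of l])
  have "pdiv p (- max_pole p (hbernpoly n l)) (coeff (hbernpoly n l) i * S i)" for i
    using S(1)[rule_format, of i] pdiv_mult_left_int[OF assms(1) pdiv_coeff_hbernpoly[OF assms(1)]]
    by (auto elim!: Ints_cases simp: mult.commute)
  then show ?thesis
    unfolding S(2) by (intro pdiv_sum assms)
qed

section \<open>The p-adic size of the expansion at an odd prime\<close>

text \<open>For negative \<open>s\<close>, upper negation gives a binomial coefficient of natural
  numbers up to sign.\<close>

lemma gbinomial_of_int_Ints: "(of_int s :: 'a :: field_char_0) gchoose m \<in> \<int>"
proof (cases "s \<ge> 0")
  case True
  then obtain n where "s = int n"
    using nonneg_int_cases by blast
  then show ?thesis
    by (simp flip: binomial_gbinomial)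
next
  case False
  define n where "n = nat (- s - 1)"
  have n: "s = - int (Suc n)"
    using False by (simp add: n_def)
  have "(of_int s :: 'a) gchoose m = (-1) ^ m * (of_nat (n + m) gchoose m)"
    unfolding n using gbinomial_minus[of "of_nat (Suc n) :: 'a" m] by (simp add: add_ac)
  then show ?thesis
    by (simp only: binomial_gbinomial [symmetric]) auto
qed

lemma gbinomial_Suc_mult:
  fixes a :: "'a :: field_char_0"
  shows "of_nat (Suc m) * (a gchoose Suc m) = (a - of_nat m) * (a gchoose m)"
  by (simp only: left_diff_distrib gbinomial_mult_1 add_diff_cancel_left')

section \<open>Odd primes and the ring of tame series\<close>

locale odd_prime =
  fixes p :: nat
  assumes prime: "prime p" and odd: "odd p"
begin

lemma p_ge_3: "p \<ge> 3"
proof -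
  have "p \<noteq> 2" using odd by auto
  with prime_ge_2_nat[OF prime] show ?thesis by linarith
qed

lemma pdiv_of_nat_self: "pdiv p 1 (of_nat p)"
  using pdiv_of_int_1[OF prime, of "int p"] by simp

lemma pdiv_mult_Ints: "pdiv p e x \<Longrightarrow> y \<in> \<int> \<Longrightarrow> pdiv p e (y * x)"
  using pdiv_mult_left_int[OF prime] by (auto elim!: Ints_cases)

text \<open>The exponents are chosen superadditive, so that tame series form a ring, and small enough that
  \<open>(q - (p - 1))!\<close> cancels the denominator of the \<open>q\<close>-th coefficient. The subtraction truncates for
  \<open>q < p - 1\<close>.\<close>

definition tame_exp :: "nat \<Rightarrow> nat" where
  "tame_exp q = (q + 1) div p - 1"

definition tame :: "rat fps \<Rightarrow> bool" where
  "tame g \<longleftrightarrow> (\<forall>q. pdiv p (- int (tame_exp q)) (g $ q))"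

text \<open>If both quotients are positive, adding them overshoots by at most one, which the
  \<open>- 1\<close> in \<open>tame_exp\<close> covers. Otherwise one exponent is 0 and monotonicity
  suffices.\<close>

lemma tame_exp_add: "tame_exp a + tame_exp b \<le> tame_exp (a + b)"
proof (cases "p \<le> a + 1 \<and> p \<le> b + 1")
  case True
  have p: "p > 0" using p_ge_3 by simp
  let ?x = "(a + 1) div p" and ?y = "(b + 1) div p"
  have "?x > 0" "?y > 0"
    using True p by (auto simp: div_greater_zero_iff)
  have "(?x + ?y) * p \<le> (a + 1) + (b + 1)"
    unfolding distrib_right by (intro add_mono) simp_all
  also have "\<dots> \<le> (a + b + 1) + p"
    using p by simp
  finally have "(?x + ?y - 1) * p \<le> a + b + 1"
    by (simp add: diff_mult_distrib)
  then have "?x + ?y - 1 \<le> (a + b + 1) div p"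
    using p by (simp add: less_eq_div_iff_mult_less_eq)
  then show ?thesis
    using \<open>?x > 0\<close> \<open>?y > 0\<close> unfolding tame_exp_def by linarith
next
  case False
  then have "tame_exp a = 0 \<or> tame_exp b = 0"
    by (auto simp: tame_exp_def)
  moreover have "tame_exp a \<le> tame_exp (a + b)" "tame_exp b \<le> tame_exp (a + b)"
    unfolding tame_exp_def by (auto intro!: diff_le_mono div_le_mono)
  ultimately show ?thesis by auto
qed

lemma tame_mult:
  assumes "tame f" "tame g"
  shows "tame (f * g)"
  unfolding tame_def fps_mult_nth
proof (intro allI pdiv_sum[OF prime])
  fix q i :: nat assume i: "i \<in> {0..q}"
  have *: "pdiv p (- int (tame_exp i) + - int (tame_exp (q - i))) (f $ i * g $ (q - i))"
    using assms unfolding tame_def by (intro pdiv_mult[OF prime]) auto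
  have "tame_exp i + tame_exp (q - i) \<le> tame_exp q"
    using tame_exp_add[of i "q - i"] i by simp
  then show "pdiv p (- int (tame_exp q)) (f $ i * g $ (q - i))"
    by (intro pdiv_mono[OF *]) (use p_ge_3 in auto)
qed

lemma tame_1: "tame 1"
  unfolding tame_def using pdiv_1_0[OF prime] prime by (auto simp: tame_exp_def)

lemma tame_power: "tame f \<Longrightarrow> tame (f ^ m)"
  by (induction m) (simp_all add: tame_1 tame_mult)

lemma tame_diff: "tame f \<Longrightarrow> tame g \<Longrightarrow> tame (f - g)"
  unfolding tame_def by (auto intro: pdiv_diff[OF prime])

text \<open>Powers of \<open>U - 1\<close> are tame and the binomial coefficients are integers, so
  negative exponents cost no further denominators.\<close>

lemma tame_powi:
  assumes "tame U" "U $ 0 = 1"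
  shows "tame (U powi s)"
  unfolding tame_def fps_powi_conv_compose[OF assms(2)] fps_compose_nth fps_binomial_nth
proof (intro allI pdiv_sum[OF prime])
  fix q i :: nat
  have "tame ((U - 1) ^ i)"
    by (intro tame_power tame_diff assms tame_1)
  then show "pdiv p (- int (tame_exp q)) ((of_int s gchoose i) * ((U - 1) ^ i) $ q)"
    by (intro pdiv_mult_Ints gbinomial_of_int_Ints) (simp add: tame_def)
qed

lemma tame_X_deriv:
  assumes "tame U"
  shows "tame (fps_X * fps_deriv U)"
  unfolding tame_def
proof
  fix q :: nat
  have "(fps_X * fps_deriv U) $ q = of_nat q * U $ q"
    by (cases q) simp_all
  then show "pdiv p (- int (tame_exp q)) ((fps_X * fps_deriv U) $ q)"
    using assms by (auto intro!: pdiv_mult_Ints simp: tame_def)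
qed

section \<open>Splitting off the coefficient of index p - 1\<close>

text \<open>The series U in f = U + z^(p-1)/p. The removed coefficient is the only one of f that is
  not tame: it has one factor p in its denominator, while \<open>tame_exp (p - 1)\<close> is
  0.\<close>

definition tame_part :: "rat fps" where
  "tame_part = log_series - fps_const (1 / of_nat p) * fps_X ^ (p - 1)"

lemma log_series_split:
  "log_series = tame_part + fps_const (1 / of_nat p) * fps_X ^ (p - 1)"
  by (simp add: tame_part_def)

lemma tame_part_nth_0: "tame_part $ 0 = 1"
  using p_ge_3 by (simp add: tame_part_def)

text \<open>The case k = 1 is exactly p >= 3; it would fail for p = 2.\<close>

lemma add_2_le_power: "k > 0 \<Longrightarrow> k + 2 \<le> p ^ k"
proof (induction k rule: nat_induct_non_zero)
  case 1
  then show ?case using p_ge_3 by simp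
next
  case (Suc k)
  have "Suc k + 2 \<le> 3 * p ^ k" using Suc by simp
  also have "\<dots> \<le> p * p ^ k" using p_ge_3 by (intro mult_right_mono) auto
  finally show ?case by simp
qed

text \<open>If p divides i + 1, write i + 1 = p^(j+1) m. The claim becomes j + 2 <= p^j m, which for
  j = 0 fails only at m = 1, the excluded index.\<close>

lemma pdiv_inverse_Suc:
  assumes "i \<noteq> p - 1"
  shows "pdiv p (- int (tame_exp i)) (1 / of_nat (i + 1))"
proof -
  have p: "p > 0" using p_ge_3 by simp
  have "\<not> is_unit p" using prime by (auto simp: prime_nat_iff)
  define k m where "k = multiplicity p (i + 1)" and "m = (i + 1) div p ^ k"
  have mk: "i + 1 = p ^ k * m"
    by (simp add: k_def m_def multiplicity_dvd del: Suc_eq_plus1 add_Suc_right)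
  have m: "\<not> p dvd m"
    unfolding k_def m_def using \<open>\<not> is_unit p\<close> by (intro multiplicity_decompose) auto
  have "m > 0" using m by (cases m) auto
  have "k \<le> tame_exp i"
  proof (cases k)
    case (Suc j)
    then have "(i + 1) div p = p ^ j * m"
      unfolding mk using p by simp
    moreover have "j + 2 \<le> p ^ j * m"
    proof (cases "j = 0")
      case True
      then have "m \<noteq> 1" using mk Suc assms by auto
      with \<open>m > 0\<close> True show ?thesis by simp
    next
      case False
      then have "j + 2 \<le> p ^ j * 1" using add_2_le_power by simp
      also have "\<dots> \<le> p ^ j * m" using \<open>m > 0\<close> by (intro mult_left_mono) auto
      finally show ?thesis .
    qed
    ultimately show ?thesis using Suc by (simp add: tame_exp_def)
  qed simp
  moreover have *: "pdiv p (- int k) (1 / of_nat (i + 1))"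
  proof (rule pdivI[of _ "int m" _ _ 1])
    show "\<not> int p dvd int m" using m by simp
    show "1 / of_nat (i + 1) = (of_nat p powi (- int k) * of_int 1 / of_int (int m) :: rat)"
      unfolding mk using p by (simp add: power_int_minus field_simps)
  qed
  ultimately show ?thesis
    using p by (intro pdiv_mono[OF *]) auto
qed

lemma tame_tame_part: "tame tame_part"
  unfolding tame_def
proof
  fix i :: nat
  show "pdiv p (- int (tame_exp i)) (tame_part $ i)"
  proof (cases "i = p - 1")
    \<comment> \<open>As p - 1 is even, the coefficient of f is +1/p and cancels completely.\<close>
    case True
    then show ?thesis
      using p_ge_3 odd prime by (simp add: tame_part_def log_series_def of_nat_diff)
  next
    case False
    then have "tame_part $ i = of_int ((-1) ^ i) * (1 / of_nat (i + 1))"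
      using False by (simp add: tame_part_def log_series_def)
    then show ?thesis
      using pdiv_mult_left_int[OF prime pdiv_inverse_Suc[OF False], of "(-1) ^ i"] by simp
  qed
qed

section \<open>Powers of p in factorials\<close>

text \<open>Each block of p consecutive factors contains a multiple of p; the induction splits off
  the top block.\<close>

lemma power_div_dvd_fact: "int p ^ (q div p) dvd fact q"
proof (induction q rule: less_induct)
  case (less q)
  show ?case
  proof (cases "q < p")
    case False
    have p: "p > 0" using p_ge_3 by simp
    have "fact q = (\<Prod>{q - p + 1..q}) * (fact (q - p) :: nat)"
      using fact_div_fact[of "q - p" q] False by (metis diff_le_self fact_dvd dvd_div_mult_self)
    moreover have "p dvd \<Prod>{q - p + 1..q}"
    proof -
      have "q div p * p \<le> q" "q < q div p * p + p"
        using p dividend_less_div_times[of p q] by (simp_all add: add.commute)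
      then have "q div p * p \<in> {q - p + 1..q}"
        using False by auto
      then have "q div p * p dvd \<Prod>{q - p + 1..q}"
        by (intro dvd_prodI[of "{q - p + 1..q}" _ "\<lambda>x. x"]) auto
      then show ?thesis by (rule dvd_mult_right)
    qed
    moreover have "p ^ ((q - p) div p) dvd fact (q - p)"
      using less[of "q - p"] False p by (simp flip: int_dvd_int_iff)
    ultimately have "p * p ^ ((q - p) div p) dvd fact q"
      by (simp add: mult_dvd_mono)
    moreover have "q div p = Suc ((q - p) div p)"
      using False p by (simp add: le_div_geq)
    ultimately show ?thesis
      by (simp flip: int_dvd_int_iff)
  qed simp
qed

lemma pdiv_fact: "pdiv p (int (q div p)) (fact q)"
  using pdiv_of_int[OF prime power_div_dvd_fact[of q]] by simp

lemma pdiv_fact_div_fact: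
  assumes "q \<le> N"
  shows "pdiv p (int (q div p)) (fact N / fact (N - q))"
proof -
  have "fact N / fact (N - q) = of_nat (N choose q) * (fact q :: rat)"
    using assms by (simp add: binomial_fact)
  then show ?thesis
    using pdiv_mult_Ints[OF pdiv_fact, of "of_nat (N choose q)"] by simp
qed

section \<open>The numbers \<open>tau\<close> and the value at 1\<close>

text \<open>The \<open>part_tau\<close> of the partition whose only nonzero entry is u_(p-1) = m,
  meant for m (p - 1) <= n; the theorem takes m = r.\<close>

definition tau :: "nat \<Rightarrow> int \<Rightarrow> nat \<Rightarrow> rat" where
  "tau n s m = fact n / fact (n - m * (p - 1)) * (of_int s gchoose m) / of_nat p ^ m"

text \<open>The binomial expansion along the splitting. The factor \<open>Z\<close> is 1 for the
  value at 1 and z U' for the value at 0.\<close>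

lemma log_series_powi_mult_nth:
  "(log_series powi s * Z) $ (k * (p - 1)) =
     (\<Sum>m\<le>k. (of_int s gchoose m) / of_nat p ^ m * (tame_part powi (s - int m) * Z) $ ((k - m) * (p - 1)))"
proof -
  let ?Y = "fps_const (1 / of_nat p) * fps_X ^ (p - 1) :: rat fps" and ?n = "k * (p - 1)"
  let ?f = "\<lambda>m. (of_int s gchoose m) * (?Y ^ m * tame_part powi (s - int m) * Z) $ ?n"
  let ?g = "\<lambda>m. (of_int s gchoose m) / of_nat p ^ m * (tame_part powi (s - int m) * Z) $ ((k - m) * (p - 1))"
  have p: "p - 1 > 0" using p_ge_3 by simp
  have Y: "(?Y ^ m * tame_part powi (s - int m) * Z) $ ?n =
      (if m \<le> k then (tame_part powi (s - int m) * Z) $ ((k - m) * (p - 1)) / of_nat p ^ m else 0)" for m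
  proof -
    have eq: "?Y ^ m * tame_part powi (s - int m) * Z =
        fps_const (1 / of_nat p ^ m) * (fps_X ^ (m * (p - 1)) * (tame_part powi (s - int m) * Z))"
      by (simp add: power_mult_distrib mult.assoc fps_const_power power_one_over mult.commute[of "p - 1"] flip: power_mult)
    show ?thesis
      unfolding eq using p by (auto simp: fps_X_power_mult_nth diff_mult_distrib)
  qed
  have "?Y $ 0 = 0" using p by simp
  then have "(log_series powi s * Z) $ ?n = (\<Sum>m\<le>?n. ?f m)"
    unfolding log_series_split by (intro fps_powi_add_nth tame_part_nth_0)
  also have "\<dots> = (\<Sum>m\<le>?n. if m \<le> k then ?g m else 0)"
    unfolding Y by (intro sum.cong) auto
  also have "\<dots> = (\<Sum>m\<le>k. ?g m)"
    using p by (intro sum.mono_neutral_cong_right) (auto intro: order_trans[of _ k])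
  finally show ?thesis .
qed

lemma log_series_powi_nth:
  "(log_series powi s) $ (k * (p - 1)) =
     (\<Sum>m\<le>k. (of_int s gchoose m) / of_nat p ^ m * (tame_part powi (s - int m)) $ ((k - m) * (p - 1)))"
  using log_series_powi_mult_nth[of s 1 k] by simp

text \<open>Trades \<open>tau n s m\<close> for \<open>tau n s (Suc m)\<close>, gaining an explicit
  factor p whenever s - m is a p-adic unit.\<close>

lemma tau_Suc:
  assumes "N = n - m * (p - 1)"
  shows "of_nat (Suc m) * of_nat p * tau n s (Suc m) =
           (of_int s - of_nat m) * (tau n s m * (fact N / fact (N - (p - 1))))"
proof -
  have "n - Suc m * (p - 1) = N - (p - 1)"
    using assms by simp
  then have "of_nat (Suc m) * of_nat p * tau n s (Suc m) =
      fact n / fact (N - (p - 1)) * (of_nat (Suc m) * (of_int s gchoose Suc m)) / of_nat p ^ m"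
    using p_ge_3 by (simp add: tau_def del: of_nat_Suc)
  also have "\<dots> = (of_int s - of_nat m) * (tau n s m * (fact N / fact (N - (p - 1))))"
    unfolding gbinomial_Suc_mult tau_def assms[symmetric] by (simp add: mult_ac)
  finally show ?thesis .
qed

text \<open>All factors except 1/p^m are integers. This crude bound starts the iteration in
  \<open>pdiv_tau_of_pdiv_log_series\<close>.\<close>

lemma pdiv_tau: "m * (p - 1) \<le> n \<Longrightarrow> pdiv p (- int m) (tau n s m)"
proof -
  assume m: "m * (p - 1) \<le> n"
  have p: "p > 0" using p_ge_3 by simp
  have "fact n / fact (n - m * (p - 1)) = (of_nat ((n choose (m * (p - 1))) * fact (m * (p - 1))) :: rat)"
    using m by (simp add: binomial_fact)
  then have "fact n / fact (n - m * (p - 1)) * (of_int s gchoose m) \<in> (\<int> :: rat set)"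
    by (simp only: Ints_mult gbinomial_of_int_Ints Ints_of_nat)
  then obtain a where "fact n / fact (n - m * (p - 1)) * (of_int s gchoose m) = (of_int a :: rat)"
    by (elim Ints_cases)
  then show ?thesis
    using p prime by (intro pdivI[of _ 1 _ _ a]) (auto simp: tau_def power_int_minus divide_simps prime_nat_iff)
qed

text \<open>For such \<open>q\<close> the subtraction in \<open>tame_exp\<close> does not truncate,
  and \<open>tame_exp q\<close> is the power of p that \<open>pdiv_fact\<close> guarantees in (q -
  (p - 1))!.\<close>

lemma tame_exp_eq:
  assumes "p - 1 \<le> q"
  shows "tame_exp q = (q - (p - 1)) div p" "(q + 1) div p = Suc (tame_exp q)"
proof -
  have "q + 1 = (q - (p - 1)) + p" "p > 0"
    using assms p_ge_3 by auto
  then have "(q + 1) div p = Suc ((q - (p - 1)) div p)"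
    by (metis div_add_self2 Suc_eq_plus1 neq0_conv)
  then show "tame_exp q = (q - (p - 1)) div p" "(q + 1) div p = Suc (tame_exp q)"
    by (simp_all add: tame_exp_def)
qed

lemma tame_exp_less_div:
  assumes "p - 1 \<le> q" "\<not> p dvd q + 1"
  shows "tame_exp q < q div p"
  using tame_exp_eq(2)[OF assms(1)] assms(2)
  by (simp add: div_Suc dvd_eq_mod_eq_0 split: if_splits)

lemma tame_exp_le_div: "tame_exp q \<le> q div p"
  by (simp add: tame_exp_def div_Suc)

text \<open>Apply z d/dz to U^s; this trades the factor \<open>q\<close> for the factor
  \<open>s\<close>.\<close>

lemma tame_part_powi_nth_mult:
  "of_nat q * (tame_part powi s) $ q =
     of_int s * (tame_part powi (s - 1) * (fps_X * fps_deriv tame_part)) $ q"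
proof -
  have "of_nat q * (tame_part powi s) $ q = (fps_X * fps_deriv (tame_part powi s)) $ q"
    by (cases q) simp_all
  also have "fps_X * fps_deriv (tame_part powi s) =
      fps_const (of_int s) * (tame_part powi (s - 1) * (fps_X * fps_deriv tame_part))"
    by (simp add: fps_deriv_powi[OF tame_part_nth_0] mult_ac flip: fps_of_int)
  finally show ?thesis by simp
qed

lemma pdiv_tame_part_powi: "pdiv p (- int (tame_exp q)) ((tame_part powi s) $ q)"
  using tame_powi[OF tame_tame_part tame_part_nth_0] by (simp add: tame_def)

lemma pdiv_tame_part_powi_deriv:
  "pdiv p (- int (tame_exp q)) ((tame_part powi s * (fps_X * fps_deriv tame_part)) $ q)"
  using tame_mult[OF tame_powi[OF tame_tame_part tame_part_nth_0] tame_X_deriv[OF tame_tame_part]]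
  by (simp add: tame_def)

text \<open>The factorials alone gain the extra factor \<open>p\<close> unless \<open>p\<close> divides \<open>q + 1\<close>; in that case \<open>q\<close> is a
  unit and the logarithmic derivative exposes the factor \<open>s\<close>.\<close>

lemma pdiv_fact_times_tame_part_powi:
  assumes "p - 1 \<le> q" "q \<le> N" "int p dvd s"
  shows "pdiv p 1 (fact N / fact (N - q) * (tame_part powi s) $ q)"
proof (cases "p dvd q + 1")
  case False
  have *: "pdiv p (int (q div p) + - int (tame_exp q)) (fact N / fact (N - q) * (tame_part powi s) $ q)"
    using assms by (intro pdiv_mult[OF prime] pdiv_fact_div_fact pdiv_tame_part_powi)
  show ?thesis
    using tame_exp_less_div[OF assms(1) False] p_ge_3 by (intro pdiv_mono[OF *]) auto
next
  case True
  have nd: "\<not> p dvd q"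
    using True p_ge_3 by (metis dvd_add_right_iff nat_dvd_1_iff_1 numeral_eq_one_iff numeral_le_one_iff semiring_norm(70))
  have "pdiv p (1 + - int (tame_exp q)) (of_nat q * (tame_part powi s) $ q)"
    unfolding tame_part_powi_nth_mult
    using assms by (intro pdiv_mult[OF prime] pdiv_of_int_1[OF prime] pdiv_tame_part_powi_deriv)
  then have "pdiv p (1 + - int (tame_exp q)) ((tame_part powi s) $ q)"
    using pdiv_of_int_dvd[OF prime, of "int q"] nd by simp
  then have *: "pdiv p (int (q div p) + (1 + - int (tame_exp q))) (fact N / fact (N - q) * (tame_part powi s) $ q)"
    using assms by (intro pdiv_mult[OF prime] pdiv_fact_div_fact)
  show ?thesis
    using tame_exp_le_div[of q] p_ge_3 by (intro pdiv_mono[OF *]) auto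
qed

text \<open>If \<open>p\<close> does not divide \<open>s - m\<close>, the term is compared with \<open>\<tau>\<^sub>m\<^sub>+\<^sub>1\<close> instead of \<open>\<tau>\<^sub>m\<close>.\<close>

lemma pdiv_lower_term:
  assumes "m < k" "k * (p - 1) \<le> n"
    and tau: "pdiv p e (tau n s m)" "pdiv p e (tau n s (Suc m))"
  shows "pdiv p (e + 1) (fact n / fact (n - k * (p - 1)) * ((of_int s gchoose m) / of_nat p ^ m
           * (tame_part powi (s - int m)) $ ((k - m) * (p - 1))))"
proof -
  define N where "N = n - m * (p - 1)"
  define q where "q = (k - m) * (p - 1)"
  define b where "b = (tame_part powi (s - int m)) $ q"
  have "m * (p - 1) + q = k * (p - 1)"
    using assms(1) by (simp add: q_def diff_mult_distrib)
  then have q: "q \<le> N" "n - k * (p - 1) = N - q"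
    using assms(2) unfolding N_def by linarith+
  have "1 * (p - 1) \<le> q"
    unfolding q_def using assms(1) by (intro mult_le_mono1) auto
  then have qp: "p - 1 \<le> q" by simp
  have eq: "fact n / fact (n - k * (p - 1)) * ((of_int s gchoose m) / of_nat p ^ m * b) =
      tau n s m * (fact N / fact (N - q) * b)"
    unfolding tau_def q(2) N_def[symmetric] by simp
  have "pdiv p (e + 1) (tau n s m * (fact N / fact (N - q) * b))"
  proof (cases "int p dvd s - int m")
    case True
    then show ?thesis
      unfolding b_def by (intro pdiv_mult[OF prime] tau pdiv_fact_times_tame_part_powi qp q(1))
  next
    case False
    \<comment> \<open>The quotient N!/(N-q)! is cut after its first p - 1 factors. These go into
      \<open>tau_Suc\<close> and produce the extra p; the remaining q - (p - 1) factors cancel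
      exactly the denominator bound \<open>tame_exp q\<close> of \<open>b\<close>.\<close>
    have "of_int (s - int m) * (tau n s m * (fact N / fact (N - q) * b)) =
       ((of_int s - of_nat m) * (tau n s m * (fact N / fact (N - (p - 1))))) *
         (fact (N - (p - 1)) / fact (N - q)) * b"
      by simp
    also have "\<dots> = of_int (int (Suc m)) * tau n s (Suc m) * of_nat p *
         (fact (N - (p - 1)) / fact ((N - (p - 1)) - (q - (p - 1)))) * b"
      using qp q(1) unfolding tau_Suc[OF N_def, symmetric] by (simp add: mult_ac del: of_nat_Suc)
    finally have "pdiv p (e + 1 + int ((q - (p - 1)) div p) + - int (tame_exp q))
      (of_int (s - int m) * (tau n s m * (fact N / fact (N - q) * b)))"
      unfolding b_def using qp q(1)
      by (simp only:) (intro pdiv_mult[OF prime] pdiv_mult_left_int[OF prime] tau pdiv_of_nat_self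
          pdiv_tame_part_powi pdiv_fact_div_fact, auto)
    also have "e + 1 + int ((q - (p - 1)) div p) + - int (tame_exp q) = e + 1"
      using tame_exp_eq(1)[OF qp] by simp
    finally show ?thesis
      by (rule pdiv_of_int_dvd[OF prime False])
  qed
  then show ?thesis
    unfolding eq[symmetric] by (simp only: b_def q_def)
qed

text \<open>The term m = k of the expansion is \<open>tau n s k\<close> itself, since powers of U
  have constant term 1; the others gain a factor p by \<open>pdiv_lower_term\<close>.\<close>

lemma pdiv_log_series_minus_tau:
  assumes "k * (p - 1) \<le> n" "\<And>m. m \<le> k \<Longrightarrow> pdiv p e (tau n s m)"
  shows "pdiv p (e + 1) (fact n / fact (n - k * (p - 1)) * (log_series powi s) $ (k * (p - 1)) - tau n s k)"
proof -
  let ?f = "\<lambda>m. fact n / fact (n - k * (p - 1)) * ((of_int s gchoose m) / of_nat p ^ m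
           * (tame_part powi (s - int m)) $ ((k - m) * (p - 1)))"
  have "fact n / fact (n - k * (p - 1)) * (log_series powi s) $ (k * (p - 1)) = (\<Sum>m\<le>k. ?f m)"
    unfolding log_series_powi_nth sum_distrib_left ..
  also have "\<dots> = (\<Sum>m<k. ?f m) + ?f k"
    by (simp add: lessThan_Suc_atMost[symmetric])
  also have "?f k = tau n s k"
    by (simp add: tau_def fps_powi_nth_0 tame_part_nth_0)
  finally have eq: "fact n / fact (n - k * (p - 1)) * (log_series powi s) $ (k * (p - 1)) - tau n s k = (\<Sum>m<k. ?f m)"
    by simp
  show ?thesis
    unfolding eq by (intro pdiv_sum[OF prime] pdiv_lower_term assms) auto
qed

text \<open>The congruence improves any common lower bound for the valuations of the \<open>\<tau>\<^sub>m\<close> below \<open>e\<close> by one, and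
  \<open>-r\<close> is one such bound.\<close>

lemma pdiv_tau_of_pdiv_log_series:
  assumes "\<And>k. k \<le> r \<Longrightarrow>
      pdiv p e (fact n / fact (n - k * (p - 1)) * (log_series powi s) $ (k * (p - 1)))"
    and "r * (p - 1) \<le> n" "m \<le> r"
  shows "pdiv p e (tau n s m)"
proof -
  have le: "m * (p - 1) \<le> n" if "m \<le> r" for m
    using mult_le_mono1[OF that, of "p - 1"] assms(2) by linarith
  have *: "pdiv p (min e (- int r + int j)) (tau n s m)" if "m \<le> r" for j m
    using that
  proof (induction j arbitrary: m)
    case 0
    show ?case
      by (rule pdiv_mono[OF pdiv_tau[OF le[OF 0]]]) (use 0 p_ge_3 in auto)
  next
    case (Suc j)
    let ?a = "fact n / fact (n - m * (p - 1)) * (log_series powi s) $ (m * (p - 1))"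
    let ?e = "min e (- int r + int j)" and ?e' = "min e (- int r + int (Suc j))"
    have "pdiv p ?e' ?a"
      by (rule pdiv_mono[OF assms(1)]) (use Suc.prems p_ge_3 in auto)
    moreover have "pdiv p ?e' (?a - tau n s m)"
      by (rule pdiv_mono[OF pdiv_log_series_minus_tau[of m n ?e s]])
        (use Suc le p_ge_3 in auto)
    ultimately have "pdiv p ?e' (?a - (?a - tau n s m))"
      by (rule pdiv_diff[OF prime])
    then show ?case by simp
  qed
  have "min e (- int r + int (nat (e + int r))) = e"
    by linarith
  with *[OF assms(3), of "nat (e + int r)"] show ?thesis by simp
qed

section \<open>The value at 0\<close>

lemma dvd_of_pdiv:
  assumes "pdiv p (int k) (of_int a)"
  shows "int p ^ k dvd a"
proof -
  obtain c b where cb: "\<not> int p dvd b" "(of_int a :: rat) = of_nat p powi (int k) * of_int c / of_int b"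
    using assms unfolding pdiv_def by blast
  have "b \<noteq> 0" using cb(1) by auto
  with cb(2) have "(of_int (a * b) :: rat) = of_int (int p ^ k * c)"
    by (simp add: field_simps)
  then have "a * b = int p ^ k * c" by (simp only: of_int_eq_iff)
  then have "int p ^ k dvd a * b" by simp
  moreover have "coprime (int p ^ k) b"
    using cb(1) prime by (simp add: prime_imp_coprime)
  ultimately show ?thesis
    by (simp add: coprime_dvd_mult_left_iff)
qed

text \<open>Split z f' = z U' + (p-1) z^(p-1)/p and expand both products with f^s. The second shifts
  m by one; its last term has no partner and becomes the leading summand. For m < r the two
  contributions merge into a multiple of \<open>tau n s m\<close>.\<close>

lemma hbernpoly_0_expansion:
  assumes r: "r > 0" and n: "n = r * (p - 1)" and s: "s = l - int n - 1"
  shows "poly (hbernpoly n l) 0 =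
     of_int l * (fact (n - 1) * (of_nat (p - 1) * (of_int s gchoose (r - 1)) / of_nat p ^ r)) +
     (\<Sum>m<r. of_int l * fact ((r - m) * (p - 1) - 1) * tau n s m *
        (tame_part powi (s - int m) * (fps_X * fps_deriv tame_part)) $ ((r - m) * (p - 1)))"
proof -
  let ?f = log_series and ?U = tame_part
  let ?Y = "fps_const (1 / of_nat p) * fps_X ^ (p - 1) :: rat fps"
  let ?D = "fps_X * fps_deriv ?U"
  define g where "g m = ((of_int s gchoose m) :: rat)" for m
  define e where "e m = (?U powi (s - int m) * ?D) $ ((r - m) * (p - 1))" for m
  define v where "v m = (?U powi (s - int m + 1)) $ ((r - m) * (p - 1))" for m
  define P where "P = (of_nat p :: rat)"
  have p: "p > 1" "P \<noteq> 0" using p_ge_3 by (auto simp: P_def)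
  have n0: "n > 0" using r p by (simp add: n)
  obtain r' where r': "r = Suc r'" using r by (cases r) auto
  have D: "fps_X * fps_deriv ?f = ?D + of_nat (p - 1) * ?Y"
  proof (rule fps_ext)
    fix i
    have X: "(fps_X * fps_deriv h) $ i = of_nat i * h $ i" for h :: "rat fps"
      by (cases i) simp_all
    show "(fps_X * fps_deriv ?f) $ i = (?D + of_nat (p - 1) * ?Y) $ i"
      unfolding fps_add_nth X by (subst log_series_split) (simp add: fps_of_nat [symmetric] algebra_simps)
  qed
  have 1: "(?f powi s * ?D) $ n = (\<Sum>m<r. g m / P ^ m * e m)"
  proof -
    have "(?f powi s * ?D) $ n = (\<Sum>m\<le>r. g m / P ^ m * e m)"
      unfolding n log_series_powi_mult_nth e_def g_def P_def ..
    also have "\<dots> = (\<Sum>m<r. g m / P ^ m * e m)"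
      by (simp add: lessThan_Suc_atMost[symmetric] e_def)
    finally show ?thesis .
  qed
  have "n = r' * (p - 1) + (p - 1)" by (simp add: n r')
  then have "(?f powi s * (of_nat (p - 1) * ?Y)) $ n = of_nat (p - 1) / P * (?f powi s) $ (r' * (p - 1))"
  proof -
    have eq: "?f powi s * (of_nat (p - 1) * ?Y) = fps_const (of_nat (p - 1) / P) * (fps_X ^ (p - 1) * ?f powi s)"
      by (simp add: P_def mult_ac flip: fps_of_nat fps_const_mult)
    show ?thesis unfolding eq using \<open>n = r' * (p - 1) + (p - 1)\<close>
      by (simp add: fps_X_power_mult_nth)
  qed
  also have "\<dots> = (\<Sum>m\<le>r'. of_nat (p - 1) * g m / P ^ Suc m * v (Suc m))"
    unfolding log_series_powi_nth sum_distrib_left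
    by (intro sum.cong) (auto simp: g_def v_def P_def r')
  also have "\<dots> = (\<Sum>m\<in>{1..r}. of_nat (p - 1) * g (m - 1) / P ^ m * v m)"
    by (rule sum.reindex_bij_witness[of _ "\<lambda>m. m - 1" Suc]) (auto simp: r')
  also have "\<dots> = of_nat (p - 1) * g (r - 1) / P ^ r + (\<Sum>m\<in>{1..<r}. of_nat (p - 1) * g (m - 1) / P ^ m * v m)"
  proof -
    have "{1..r} = insert r {1..<r}" using r by auto
    moreover have "v r = 1" by (simp add: v_def fps_powi_nth_0 tame_part_nth_0)
    ultimately show ?thesis by simp
  qed
  \<comment> \<open>A zero summand at m = 0 brings this sum to the range m < r of the other one, for
    termwise addition.\<close>
  also have "(\<Sum>m\<in>{1..<r}. of_nat (p - 1) * g (m - 1) / P ^ m * v m) =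
      (\<Sum>m<r. if m = 0 then 0 else of_nat (p - 1) * g (m - 1) / P ^ m * v m)"
    by (intro sum.mono_neutral_cong_left) auto
  finally have 2: "(?f powi s * (of_nat (p - 1) * ?Y)) $ n = of_nat (p - 1) * g (r - 1) / P ^ r +
      (\<Sum>m<r. if m = 0 then 0 else of_nat (p - 1) * g (m - 1) / P ^ m * v m)" .
  have B: "poly (hbernpoly n l) 0 = of_int l * fact (n - 1) * (?f powi s * (fps_X * fps_deriv ?f)) $ n"
  proof -
    have "poly (hbernpoly n l) 0 = fact (n - 1) * (of_nat n * (bern_series powi l) $ n)"
      unfolding poly_hbernpoly_0 using n0 by (simp add: fact_reduce)
    then show ?thesis
      unfolding bern_series_powi_nth s by simp
  qed
  \<comment> \<open>With q = (r-m)(p-1), the relations q v_m = (s-m+1) e_m and (s-m+1) binom(s,m-1)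
    = m binom(s,m) show that q times the bracket is q + m(p-1) = n times its first term. Then n
    (n-1)! / q is rewritten as (q-1)! n!/q!.\<close>
  have summand: "of_int l * fact (n - 1) * (g m / P ^ m * e m + (if m = 0 then 0 else of_nat (p - 1) * g (m - 1) / P ^ m * v m))
      = of_int l * fact ((r - m) * (p - 1) - 1) * tau n s m * e m" if m: "m < r" for m
  proof -
    define q where "q = (r - m) * (p - 1)"
    have q: "q > 0" using m p by (simp add: q_def)
    have "n = ((r - m) + m) * (p - 1)" using m by (simp add: n)
    then have nq: "n = q + m * (p - 1)" by (simp only: q_def add_mult_distrib)
    have nq': "n - m * (p - 1) = q" by (simp add: nq)
    have ve: "of_nat q * v m = of_int (s - int m + 1) * e m"
      using tame_part_powi_nth_mult[of q "s - int m + 1"] by (simp add: v_def e_def q_def)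
    have "of_nat q * (if m = 0 then 0 else of_nat (p - 1) * g (m - 1) / P ^ m * v m)
        = of_nat (m * (p - 1)) * g m / P ^ m * e m"
    proof (cases m)
      case (Suc j)
      have "of_nat q * (of_nat (p - 1) * g j / P ^ m * v m) = of_nat (p - 1) * g j / P ^ m * (of_nat q * v m)"
        by simp
      also have "\<dots> = of_nat (p - 1) * ((of_int s - of_nat j) * g j) / P ^ m * e m"
        unfolding ve by (simp add: Suc)
      also have "(of_int s - of_nat j) * g j = of_nat m * g m"
        unfolding Suc g_def by (rule gbinomial_Suc_mult[symmetric])
      finally have "of_nat q * (of_nat (p - 1) * g j / P ^ m * v m) =
        of_nat (p - 1) * (of_nat m * g m) / P ^ m * e m" .
      moreover have "m \<noteq> 0" "m - 1 = j" using Suc by auto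
      ultimately show ?thesis by (simp only: if_False of_nat_mult mult_ac)
    qed simp
    then have "of_nat q * (g m / P ^ m * e m + (if m = 0 then 0 else of_nat (p - 1) * g (m - 1) / P ^ m * v m))
        = (of_nat q + of_nat (m * (p - 1))) * (g m / P ^ m * e m)"
      by (simp only: distrib_left distrib_right) (simp add: mult_ac)
    also have "\<dots> = of_nat n * (g m / P ^ m * e m)"
      unfolding nq by simp
    finally have **: "of_nat q * (g m / P ^ m * e m + (if m = 0 then 0 else of_nat (p - 1) * g (m - 1) / P ^ m * v m))
        = of_nat n * (g m / P ^ m * e m)" .
    have *: "g m / P ^ m * e m + (if m = 0 then 0 else of_nat (p - 1) * g (m - 1) / P ^ m * v m)
        = of_nat n * (g m / P ^ m * e m) / of_nat q"
      unfolding **[symmetric] by (rule nonzero_mult_div_cancel_left[symmetric]) (use q in simp)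
    have "fact (n - 1) * of_nat n = (fact n :: rat)" "fact q = of_nat q * (fact (q - 1) :: rat)"
      using n0 q by (simp_all add: fact_reduce)
    then have "of_int l * fact (n - 1) * (of_nat n * (g m / P ^ m * e m) / of_nat q) =
        of_int l * fact (q - 1) * (fact n / fact q * g m / P ^ m) * e m"
      using q by (simp add: field_simps)
    then show ?thesis
      unfolding * tau_def nq' q_def[symmetric] g_def[symmetric] P_def[symmetric] .
  qed
  have "poly (hbernpoly n l) 0 = of_int l * fact (n - 1) *
      ((\<Sum>m<r. g m / P ^ m * e m) + (of_nat (p - 1) * g (r - 1) / P ^ r +
      (\<Sum>m<r. if m = 0 then 0 else of_nat (p - 1) * g (m - 1) / P ^ m * v m)))"
    unfolding B D distrib_left[of "?f powi s"] fps_add_nth 1 2 ..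
  also have "\<dots> = of_int l * fact (n - 1) * (of_nat (p - 1) * g (r - 1) / P ^ r) +
      (\<Sum>m<r. of_int l * fact (n - 1) * (g m / P ^ m * e m + (if m = 0 then 0 else of_nat (p - 1) * g (m - 1) / P ^ m * v m)))"
    unfolding sum_distrib_left[symmetric] sum.distrib by (simp only: distrib_left add_ac)
  also have "\<dots> = of_int l * fact (n - 1) * (of_nat (p - 1) * g (r - 1) / P ^ r) +
      (\<Sum>m<r. of_int l * fact ((r - m) * (p - 1) - 1) * tau n s m * e m)"
    by (intro arg_cong2[where f = "(+)"] refl sum.cong summand) auto
  finally show ?thesis
    by (simp only: g_def P_def e_def mult.assoc)
qed

text \<open>One factor p beyond the bound \<open>e\<close> must come from \<open>l\<close>, from the
  factorial, or from the passage to \<open>tau n s (Suc m)\<close>. The relation l = (s - m) + p m +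
  (q + 1) links the divisibility conditions that separate the cases.\<close>

lemma pdiv_hbernpoly_0_term:
  assumes "m < r" and n: "n = r * (p - 1)" and s: "s = l - int n - 1"
    and tau: "pdiv p e (tau n s m)" "pdiv p e (tau n s (Suc m))"
  shows "pdiv p (e + 1) (of_int l * fact ((r - m) * (p - 1) - 1) * tau n s m *
        (tame_part powi (s - int m) * (fps_X * fps_deriv tame_part)) $ ((r - m) * (p - 1)))"
proof -
  define q where "q = (r - m) * (p - 1)"
  define E where "E = (tame_part powi (s - int m) * (fps_X * fps_deriv tame_part)) $ q"
  define v where "v = (tame_part powi (s - int m + 1)) $ q"
  have p: "p > 0" "p \<ge> 3" using p_ge_3 by auto
  have "1 * (p - 1) \<le> q"
    unfolding q_def using assms(1) by (intro mult_le_mono1) auto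
  then have qp: "p - 1 \<le> q" by simp
  then have q: "q > 0" using p by linarith
  have nq: "n - m * (p - 1) = q"
    by (simp add: n q_def diff_mult_distrib)
  have iq: "int q = (int r - int m) * (int p - 1)"
    using assms(1) p by (simp add: q_def of_nat_diff)
  have sq: "s = l - int r * (int p - 1) - 1"
    using p by (simp add: s n of_nat_diff)
  have Ev: "of_int (s - int m + 1) * E = of_nat q * v"
    using tame_part_powi_nth_mult[of q "s - int m + 1"] by (simp add: E_def v_def)
  have pE: "pdiv p (- int (tame_exp q)) E"
    unfolding E_def by (rule pdiv_tame_part_powi_deriv)
  have pv: "pdiv p (- int (tame_exp q)) v"
    unfolding v_def by (rule pdiv_tame_part_powi)
  have fq: "fact q = of_nat q * (fact (q - 1) :: rat)"
    using q by (simp add: fact_reduce)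
  define T where "T = of_int l * fact (q - 1) * tau n s m * E"
  have "pdiv p (e + 1) T"
  proof (cases "int p dvd l")
    \<comment> \<open>Here \<open>l\<close> supplies the extra p, and (q - 1)! suffices against the
      denominator of \<open>E\<close>.\<close>
    case True
    have "(q + 1) div p \<le> (q - 1 + p) div p"
      using p by (intro div_le_mono) auto
    then have le: "Suc (tame_exp q) \<le> Suc ((q - 1) div p)"
      unfolding tame_exp_eq(2)[OF qp] using p by simp
    have *: "pdiv p (1 + int ((q - 1) div p) + e + - int (tame_exp q)) T"
      unfolding T_def by (intro pdiv_mult[OF prime] pdiv_of_int_1[OF prime] True pdiv_fact tau pE)
    show ?thesis
      by (rule pdiv_mono[OF *]) (use le p in auto)
  next
    case l: False
    show ?thesis
    proof (cases "int p dvd s - int m")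
      \<comment> \<open>Here s - m + 1 is a unit, and multiplying by it turns (q - 1)! E into q! v.
        As p does not divide q + 1, q! beats the denominator bound of \<open>v\<close> by a factor
        p.\<close>
      case True
      have nd: "\<not> int p dvd s - int m + 1"
      proof
        assume "int p dvd s - int m + 1"
        then have "int p dvd (s - int m + 1) - (s - int m)" using True by (rule dvd_diff)
        then show False using p by simp
      qed
      have "\<not> p dvd q + 1"
      proof
        assume "p dvd q + 1"
        then have "int p dvd int (q + 1)" by (simp only: int_dvd_int_iff)
        moreover have "l = (s - int m) + int p * int m + int (q + 1)"
          unfolding sq by (simp add: iq algebra_simps)
        ultimately have "int p dvd l" using True by (simp only: dvd_add dvd_triv_left)
        with l show False ..
      qed
      then have less: "tame_exp q < q div p"
        by (rule tame_exp_less_div[OF qp])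
      have "of_int (s - int m + 1) * T = of_int l * (fact (q - 1)) * tau n s m * (of_int (s - int m + 1) * E)"
        by (simp add: T_def mult_ac)
      also have "\<dots> = of_int l * (fact q * tau n s m * v)"
        unfolding Ev fq by (simp add: mult_ac)
      finally have "pdiv p (int (q div p) + e + - int (tame_exp q)) (of_int (s - int m + 1) * T)"
        by (simp only:) (intro pdiv_mult[OF prime] pdiv_mult_left_int[OF prime] pdiv_fact tau pv)
      then have *: "pdiv p (int (q div p) + e + - int (tame_exp q)) T"
        by (rule pdiv_of_int_dvd[OF prime nd])
      show ?thesis
        by (rule pdiv_mono[OF *]) (use less p in auto)
    next
      \<comment> \<open>Now s - m is a unit, so \<open>tau_Suc\<close> supplies the extra p;
        multiplying by q completes (q - 1)! to q!.\<close>
      case sm: False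
      define R where "R = of_int (int (Suc m)) * tau n s (Suc m) * of_nat p * (fact (q - (p - 1)) :: rat)"
      have "R = of_nat (Suc m) * of_nat p * tau n s (Suc m) * fact (q - (p - 1))"
        by (simp only: R_def of_int_of_nat_eq mult_ac)
      also have "\<dots> = of_int (s - int m) * (tau n s m * fact q)"
        unfolding tau_Suc[OF nq[symmetric]] by simp
      finally have R: "of_int (s - int m) * (tau n s m * fact q) = R" ..
      have pR: "pdiv p (e + 1 + int (tame_exp q)) R"
        unfolding R_def tame_exp_eq(1)[OF qp]
        by (intro pdiv_mult[OF prime] pdiv_mult_left_int[OF prime] tau pdiv_of_nat_self pdiv_fact)
      have T: "of_int (s - int m) * (of_nat q * T) = of_int l * (R * E)"
        unfolding R[symmetric] T_def fq by (simp add: mult_ac)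
      show ?thesis
      proof (cases "p dvd q")
        case False
        have "pdiv p (e + 1) (R * E)"
          using pdiv_mult[OF prime pR pE] by simp
        then have *: "pdiv p (e + 1) (of_int (s - int m) * (of_int (int q) * T))"
          unfolding of_int_of_nat_eq T by (rule pdiv_mult_left_int[OF prime])
        have "\<not> int p dvd int q" using False by simp
        then show ?thesis
          by (rule pdiv_of_int_dvd[OF prime _ pdiv_of_int_dvd[OF prime sm *]])
      next
        \<comment> \<open>Now q is not a unit, but s - m + 1 is; passing from \<open>E\<close> to
          \<open>v\<close> produces a factor q that cancels the one introduced.\<close>
        case True
        have nd: "\<not> int p dvd s - int m + 1"
        proof
          assume "int p dvd s - int m + 1"
          moreover have "l = (s - int m + 1) + int q + int p * int m"
            unfolding sq by (simp add: iq algebra_simps)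
          moreover have "int p dvd int q" using True by (simp only: int_dvd_int_iff)
          ultimately have "int p dvd l" by (simp only: dvd_add dvd_triv_left)
          with l show False ..
        qed
        have "of_nat q * (of_int (s - int m) * (of_int (s - int m + 1) * T)) =
            of_int (s - int m + 1) * (of_int (s - int m) * (of_nat q * T))"
          by (simp only: mult_ac)
        also have "\<dots> = of_int l * (R * (of_int (s - int m + 1) * E))"
          unfolding T by (simp only: mult_ac)
        also have "\<dots> = of_nat q * (of_int l * (R * v))"
          unfolding Ev by (simp only: mult_ac)
        finally have eq: "of_int (s - int m) * (of_int (s - int m + 1) * T) = of_int l * (R * v)"
          using q by simp
        have "pdiv p (e + 1) (R * v)"
          using pdiv_mult[OF prime pR pv] by simp
        then have *: "pdiv p (e + 1) (of_int (s - int m) * (of_int (s - int m + 1) * T))"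
          unfolding eq by (rule pdiv_mult_left_int[OF prime])
        show ?thesis
          by (rule pdiv_of_int_dvd[OF prime nd pdiv_of_int_dvd[OF prime sm *]])
      qed
    qed
  qed
  then show ?thesis
    by (simp only: T_def E_def q_def)
qed

section \<open>From congruences to exact valuations\<close>

lemma padic_val_eq_cong:
  assumes "pdiv p e x" "pdiv p (e + 1) (x - y)"
  shows "padic_val p x = ereal (of_int e) \<longleftrightarrow> padic_val p y = ereal (of_int e)"
proof -
  have *: "pdiv p e (x - y)"
    by (rule pdiv_mono[OF assms(2)]) (use p_ge_3 in auto)
  have "pdiv p e y"
    using pdiv_diff[OF prime assms(1) *] by simp
  moreover have "pdiv p (e + 1) x \<longleftrightarrow> pdiv p (e + 1) y"
    using pdiv_diff[OF prime _ assms(2), of x] pdiv_add[OF prime assms(2), of y] by auto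
  ultimately show ?thesis
    using assms(1) by (simp add: padic_val_eq_iff[OF prime])
qed

text \<open>By Legendre's formula n! contributes r - sigma_p(n)/(p-1), and the denominator p^r
  cancels the r.\<close>

lemma padic_val_tau_iff:
  assumes "n = r * (p - 1)"
  shows "padic_val p (tau n s r) = ereal (of_int (- M)) \<longleftrightarrow>
    padic_val p (of_int s gchoose r) = ereal (real (digit_sum p n) / real (p - 1) - of_int M)"
proof -
  have p: "p > 1" using p_ge_3 by simp
  have "tau n s r * of_nat p ^ r = fact n * (of_int s gchoose r)"
    using p by (simp add: tau_def assms)
  then have "padic_val p (tau n s r) + ereal (real r) =
      ereal ((real n - real (digit_sum p n)) / real (p - 1)) + padic_val p (of_int s gchoose r)"
    by (metis padic_val_mult[OF prime] padic_val_power_self[OF prime] padic_val_fact[OF prime])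
  also have "(real n - real (digit_sum p n)) / real (p - 1) = real r - real (digit_sum p n) / real (p - 1)"
    using p by (simp add: assms diff_divide_distrib)
  finally show ?thesis
    by (cases "padic_val p (tau n s r)"; cases "padic_val p (of_int s gchoose r)") auto
qed

lemma part_tau_eq_tau:
  assumes "n = r * (p - 1)"
  shows "part_tau n (\<lambda>i. if i = p - 1 then r else 0) s = tau n s r"
proof (cases "r = 0")
  case True
  then show ?thesis
    by (simp add: part_tau_def part_t_def part_supp_def part_size_def part_weight_def tau_def)
next
  case False
  have p: "p - 1 \<ge> 1" "p > 0" using p_ge_3 by auto
  have "part_supp (\<lambda>i. if i = p - 1 then r else 0) = {p - 1}"
    using False p by (auto simp: part_supp_def)
  then show ?thesis
    using p by (simp add: part_tau_def part_t_def part_size_def part_weight_def tau_def assms mult.commute)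
qed

lemma pdiv_max_pole_tau:
  assumes "m * (p - 1) \<le> n"
  shows "pdiv p (- max_pole p (hbernpoly n l)) (tau n (l - int n - 1) m)"
proof (rule pdiv_tau_of_pdiv_log_series[OF _ assms order_refl])
  fix k assume "k \<le> m"
  then have "k * (p - 1) \<le> n"
    using mult_le_mono1[of k m "p - 1"] assms by linarith
  then show "pdiv p (- max_pole p (hbernpoly n l))
      (fact n / fact (n - k * (p - 1)) * (log_series powi (l - int n - 1)) $ (k * (p - 1)))"
    by (rule pdiv_log_series_powi_nth[OF prime])
qed

lemma padic_val_hbernpoly_1_iff:
  assumes "n = r * (p - 1)"
  shows "padic_val p (poly (hbernpoly n l) 1) = ereal (of_int (- max_pole p (hbernpoly n l))) \<longleftrightarrow>
    padic_val p (tau n (l - int n - 1) r) = ereal (of_int (- max_pole p (hbernpoly n l)))"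
proof (rule padic_val_eq_cong)
  let ?M = "max_pole p (hbernpoly n l)" and ?s = "l - int n - 1"
  have B: "poly (hbernpoly n l) 1 =
      fact n / fact (n - r * (p - 1)) * (log_series powi ?s) $ (r * (p - 1))"
    by (simp add: poly_hbernpoly_1 assms)
  show "pdiv p (- ?M) (poly (hbernpoly n l) 1)"
    unfolding B by (rule pdiv_log_series_powi_nth[OF prime]) (simp add: assms)
  have "pdiv p (- ?M) (tau n ?s m)" if "m \<le> r" for m
    using mult_le_mono1[OF that, of "p - 1"] by (intro pdiv_max_pole_tau) (simp add: assms)
  then show "pdiv p (- ?M + 1) (poly (hbernpoly n l) 1 - tau n ?s r)"
    unfolding B by (intro pdiv_log_series_minus_tau) (simp_all add: assms)
qed

text \<open>Take c to be the exact power of p in \<open>l\<close>. It divides n by hypothesis, hence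
  r, because p - 1 is prime to p. Thus l / (l - r p) equals l' / (l' - p r'), a quotient of p-adic
  units.\<close>

lemma unit_decomposition:
  assumes "r > 0" "n = r * (p - 1)" "padic_val p (of_int l) \<le> padic_val p (of_nat n)"
  obtains c l' r' where "l = c * l'" "int r * int p = c * (int p * r')" "c \<noteq> 0" "\<not> int p dvd l'"
proof -
  have p: "p > 1" using p_ge_3 by simp
  have n: "n > 0" using assms p by simp
  have l: "l \<noteq> 0"
  proof
    assume "l = 0"
    then have "padic_val p (of_nat n) = \<infinity>"
      using assms(3) by (simp add: padic_val_def)
    then show False using n by (simp add: padic_val_def)
  qed
  define k where "k = multiplicity (int p) l"
  have nu: "\<not> is_unit (int p)" using p by simp
  obtain l' where l': "l = int p ^ k * l'" using multiplicity_dvd[of "int p" l] unfolding k_def by (rule dvdE)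
  have nd: "\<not> int p dvd l'"
    using multiplicity_decompose[OF l nu] l' p unfolding k_def[symmetric] by simp
  have "pdiv p (int k) (of_int l)"
    by (rule pdiv_of_int[OF prime]) (simp add: l')
  then have "ereal (of_int (int k)) \<le> padic_val p (of_int (int n))"
    using assms(3) by (simp add: padic_val_ge_iff[OF prime, symmetric])
  then have "pdiv p (int k) (of_int (int n))"
    by (simp only: padic_val_ge_iff[OF prime])
  then have "int p ^ k dvd int n"
    by (rule dvd_of_pdiv)
  then have "int p ^ k dvd int r * (int p - 1)"
    using p by (simp add: assms(2) of_nat_diff)
  moreover have "\<not> int p dvd int p - 1"
    using p by (intro zdvd_not_zless) auto
  then have "coprime (int p ^ k) (int p - 1)"
    using prime by (simp add: prime_imp_coprime)
  ultimately have "int p ^ k dvd int r"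
    by (simp add: coprime_dvd_mult_left_iff)
  then obtain r' where "int r = int p ^ k * r'" ..
  then have "int r * int p = int p ^ k * (int p * r')" by simp
  then show ?thesis
    using that[OF l' _ _ nd] p by simp
qed

lemma padic_val_hbernpoly_0_iff:
  assumes n: "n = r * (p - 1)" and le: "padic_val p (of_int l) \<le> padic_val p (of_nat n)"
  shows "padic_val p (poly (hbernpoly n l) 0) = ereal (of_int (- max_pole p (hbernpoly n l))) \<longleftrightarrow>
    padic_val p (tau n (l - int n - 1) r) = ereal (of_int (- max_pole p (hbernpoly n l)))"
proof (cases "r = 0")
  case True
  then have "poly (hbernpoly n l) 0 = tau n (l - int n - 1) r"
    by (simp add: n tau_def poly_hbernpoly_0 fps_powi_nth_0)
  then show ?thesis by simp
next
  case False
  then have r: "r > 0" by simp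
  let ?M = "max_pole p (hbernpoly n l)"
  define s where "s = l - int n - 1"
  \<comment> \<open>The leading summand of \<open>hbernpoly_0_expansion\<close>; the others vanish
    modulo p^(1-M).\<close>
  define X where "X = of_int l * (fact (n - 1) * (of_nat (p - 1) * (of_int s gchoose (r - 1)) / of_nat p ^ r) :: rat)"
  have p: "p > 1" using p_ge_3 by simp
  have tau: "pdiv p (- ?M) (tau n s m)" if "m \<le> r" for m
    using mult_le_mono1[OF that, of "p - 1"] unfolding s_def by (intro pdiv_max_pole_tau) (simp add: n)
  have "pdiv p (- ?M + 1) (poly (hbernpoly n l) 0 - X)"
    unfolding hbernpoly_0_expansion[OF r n s_def] X_def add_diff_cancel_left'
    by (intro pdiv_sum[OF prime] pdiv_hbernpoly_0_term[OF _ n s_def] tau) auto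
  moreover have "pdiv p (- ?M) (poly (hbernpoly n l) 0)"
    using pdiv_coeff_hbernpoly[OF prime, of n l 0] by (simp add: poly_0_coeff_0)
  ultimately have "padic_val p (poly (hbernpoly n l) 0) = ereal (of_int (- ?M)) \<longleftrightarrow>
      padic_val p X = ereal (of_int (- ?M))"
    by (intro padic_val_eq_cong)
  also obtain c l' r' where c: "l = c * l'" "int r * int p = c * (int p * r')" "c \<noteq> 0" "\<not> int p dvd l'"
    using unit_decomposition[OF r n le] .
  \<comment> \<open>Uses s - (r - 1) = l - r p and the ratio of consecutive binomial
    coefficients.\<close>
  have "of_int (l - int r * int p) * X = of_int l * tau n s r"
  proof -
    obtain j where j: "r = Suc j" using r by (cases r) auto
    have "int n = int r * (int p - 1)"
      using p by (simp add: n of_nat_diff)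
    then have "l - int r * int p = s - int j"
      by (simp add: s_def j algebra_simps)
    then have "(of_int (l - int r * int p) :: rat) = of_int s - of_nat j"
      by simp
    then have "of_int (l - int r * int p) * (of_int s gchoose j) = of_nat r * ((of_int s gchoose r) :: rat)"
      unfolding j by (simp only: gbinomial_Suc_mult)
    then have "of_int (l - int r * int p) * X =
        of_int l * (fact (n - 1) * (of_nat (p - 1) * (of_nat r * (of_int s gchoose r)) / of_nat p ^ r))"
      unfolding X_def j by (simp add: mult_ac del: of_nat_Suc)
    also have "\<dots> = of_int l * (fact n * (of_int s gchoose r) / of_nat p ^ r)"
    proof -
      have "fact n = of_nat n * (fact (n - 1) :: rat)"
        using r p by (simp add: fact_reduce n)
      then show ?thesis by (simp add: n mult_ac)
    qed
    finally show ?thesis by (simp add: tau_def n)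
  qed
  then have "of_int c * (of_int (l' - int p * r') * X) = of_int c * (of_int l' * tau n s r)"
    unfolding c(1,2) by (simp add: algebra_simps)
  then have eq: "of_int (l' - int p * r') * X = of_int l' * tau n s r"
    using c(3) by simp
  have nd: "\<not> int p dvd l' - int p * r'"
    using c(4) by (simp add: dvd_diff_left_iff)
  have "padic_val p X = padic_val p (tau n s r)"
    using arg_cong[OF eq, of "padic_val p"]
    by (simp only: padic_val_mult[OF prime] padic_val_of_int_unit[OF prime c(4)]
        padic_val_of_int_unit[OF prime nd] add_0_left)
  finally show ?thesis by (simp add: s_def)
qed

end

section \<open>The equivalences (a), (b) and (c)\<close>

theorem theorem5p11:
  fixes p n r :: nat and l M M' :: int and u :: "nat \<Rightarrow> nat"
  assumes "prime p" and "odd p"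
    and "n = r * (p - 1)"
    and "M = max_pole p (hbernpoly n l)"
    and "M' = max_pole p (hbernpoly n (l + 1))"
    and "u = (\<lambda>i. if i = p - 1 then r else 0)"
  shows
    "part_tau n u (l - int n - 1) = fact n * (of_int (l - int n - 1) gchoose r) / of_nat p ^ r
     \<and> part_tau n u (l - int n) = fact n * (of_int (l - int n) gchoose r) / of_nat p ^ r
     \<comment> \<open>(a)\<close>
     \<and> (SAMPC p n (l - 1) \<longleftrightarrow>
          padic_val p (of_int (l - int n - 1) gchoose r)
            = ereal (real (digit_sum p n) / real (p - 1) - of_int M))
     \<and> (padic_val p (of_int (l - int n - 1) gchoose r)
            = ereal (real (digit_sum p n) / real (p - 1) - of_int M) \<longleftrightarrow>
          padic_val p (part_tau n u (l - int n - 1)) = ereal (of_int (- M))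
          \<and> ereal (of_int (- M)) = padic_val p (poly (hbernpoly n l) 1))
     \<comment> \<open>(b)\<close>
     \<and> (padic_val p (of_int l) \<le> padic_val p (of_nat n) \<longrightarrow>
          (AMPC p n l \<longleftrightarrow>
             padic_val p (part_tau n u (l - int n - 1)) = ereal (of_int (- M))
             \<and> ereal (of_int (- M)) = padic_val p (poly (hbernpoly n l) 0))
          \<and> (padic_val p (part_tau n u (l - int n - 1)) = ereal (of_int (- M))
             \<and> ereal (of_int (- M)) = padic_val p (poly (hbernpoly n l) 0) \<longleftrightarrow>
             padic_val p (of_int (l - int n - 1) gchoose r)
               = ereal (real (digit_sum p n) / real (p - 1) - of_int M))
          \<and> (SAMPC p n (l - 1) \<longleftrightarrow> AMPC p n l)
          \<and> (SAMPC p n (l - 1) \<or> AMPC p n l \<longrightarrow>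
             padic_val p (poly (hbernpoly n l) 0) = padic_val p (poly (hbernpoly n l) 1)))
     \<comment> \<open>(c)\<close>
     \<and> (padic_val p (of_int l) > padic_val p (of_nat n) \<longrightarrow>
          padic_val p (of_int (l + 1)) \<le> padic_val p (of_nat n)
          \<and> (AMPC p n (l + 1) \<longleftrightarrow>
             padic_val p (part_tau n u (l - int n)) = ereal (of_int (- M'))
             \<and> ereal (of_int (- M')) = padic_val p (poly (hbernpoly n (l + 1)) 0))
          \<and> (padic_val p (part_tau n u (l - int n)) = ereal (of_int (- M'))
             \<and> ereal (of_int (- M')) = padic_val p (poly (hbernpoly n (l + 1)) 0) \<longleftrightarrow>
             padic_val p (of_int (l - int n) gchoose r)
               = ereal (real (digit_sum p n) / real (p - 1) - of_int M'))
          \<and> (SAMPC p n l \<longleftrightarrow> AMPC p n (l + 1))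
          \<and> (SAMPC p n l \<or> AMPC p n (l + 1) \<longrightarrow>
             padic_val p (poly (hbernpoly n (l + 1)) 0)
               = padic_val p (poly (hbernpoly n (l + 1)) 1)))"
proof -
  interpret odd_prime p
    by standard (fact assms)+
  note n = assms(3) and M = assms(4) and M' = assms(5)
  let ?B = "hbernpoly n l" and ?B' = "hbernpoly n (l + 1)"
  have tau: "part_tau n u s = tau n s r" for s
    unfolding assms(6) by (rule part_tau_eq_tau[OF n])
  have tau_eq: "tau n s r = fact n * (of_int s gchoose r) / of_nat p ^ r" for s
    by (simp add: tau_def n)
  have shift: "l + 1 - int n - 1 = l - int n" "l - 1 + 1 = l" by simp_all
  have S: "SAMPC p n (l - 1) \<longleftrightarrow> padic_val p (tau n (l - int n - 1) r) = ereal (of_int (- M))"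
    unfolding SAMPC_def shift(2) M by (rule padic_val_hbernpoly_1_iff[OF n])
  have S': "SAMPC p n l \<longleftrightarrow> padic_val p (tau n (l - int n) r) = ereal (of_int (- M'))"
    unfolding SAMPC_def M' using padic_val_hbernpoly_1_iff[OF n, of "l + 1"] by (simp only: shift)
  have v1: "padic_val p (poly ?B 1) = ereal (of_int (- M)) \<longleftrightarrow> SAMPC p n (l - 1)"
    unfolding SAMPC_def shift(2) M ..
  have v1': "padic_val p (poly ?B' 1) = ereal (of_int (- M')) \<longleftrightarrow> SAMPC p n l"
    unfolding SAMPC_def M' ..
  have A: "AMPC p n l \<longleftrightarrow> SAMPC p n (l - 1)" if "padic_val p (of_int l) \<le> padic_val p (of_nat n)"
    unfolding S unfolding AMPC_def M by (rule padic_val_hbernpoly_0_iff[OF n that])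
  have A': "AMPC p n (l + 1) \<longleftrightarrow> SAMPC p n l" if "padic_val p (of_int (l + 1)) \<le> padic_val p (of_nat n)"
    unfolding S' unfolding AMPC_def M' using padic_val_hbernpoly_0_iff[OF n that] by (simp only: shift)
  have v0: "padic_val p (poly ?B 0) = ereal (of_int (- M)) \<longleftrightarrow> AMPC p n l"
    unfolding AMPC_def M ..
  have v0': "padic_val p (poly ?B' 0) = ereal (of_int (- M')) \<longleftrightarrow> AMPC p n (l + 1)"
    unfolding AMPC_def M' ..
  have c: "padic_val p (of_int (l + 1)) \<le> padic_val p (of_nat n)"
    if "padic_val p (of_int l) > padic_val p (of_nat n)"
  proof -
    have n0: "0 \<le> padic_val p (of_nat n)"
      using pdiv_of_int_0[OF prime, of "int n"] padic_val_ge_iff[OF prime, of 0 "of_nat n"]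
      by (simp add: zero_ereal_def)
    \<comment> \<open>A valuation above that of n is positive, so p divides \<open>l\<close> and l +
      1 is a unit.\<close>
    have "int p dvd l"
    proof (rule ccontr)
      assume "\<not> int p dvd l"
      then show False
        using that n0 by (simp add: padic_val_of_int_unit[OF prime])
    qed
    then have "\<not> int p dvd l + 1"
      using p_ge_3 by (simp add: dvd_add_right_iff)
    then have "padic_val p (of_int (l + 1)) = 0"
      by (rule padic_val_of_int_unit[OF prime])
    with n0 show ?thesis by simp
  qed
  note iff = padic_val_tau_iff[OF n, symmetric]
  have e: "ereal (of_int (- M)) = x \<longleftrightarrow> x = ereal (of_int (- M))"
    "ereal (of_int (- M')) = x \<longleftrightarrow> x = ereal (of_int (- M'))" for x by auto
  have eq: "padic_val p (poly ?B 0) = padic_val p (poly ?B 1)" if "AMPC p n l" "SAMPC p n (l - 1)"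
    using that v0 v1 by simp
  have eq': "padic_val p (poly ?B' 0) = padic_val p (poly ?B' 1)" if "AMPC p n (l + 1)" "SAMPC p n l"
    using that v0' v1' by simp
  \<comment> \<open>Rewriting turns the valuation conditions involving \<open>M\<close> and
    \<open>M'\<close> into \<open>SAMPC\<close> or \<open>AMPC\<close>; the rest is
    propositional.\<close>
  show ?thesis
    unfolding tau iff e v0 v0' v1 S[symmetric] S'[symmetric]
    using tau_eq A A' c eq eq' by blast
qed

end
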